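(* Let $R$ be a finite principal left ideal ring and $P$ a multiplicative property on $R^n$. Let $C\subseteq R^n$ be a free left submodule such that $P[x]$ holds for all nonzero $x\in C$. Then there exist a respectful order $<$ on $R$ and an ordered basis $B$ of $R^n$ such that $C\subseteq C(<,B,P)$.
   Context: $R^\ast$ is the unit group of $R$. A property $P:R^n\to\{\text{true},\text{false}\}$ is multiplicative if $P[ux]=P[x]=P[xu]$ for all $u\in R^\ast$, $x\in R^n$. A total order $<$ on $R$ is respectful if for all nonzero $x,y\in R$ with $Rx\supsetneq Ry$ there is $\alpha\in R^\ast$ with $\alpha x<uy$ for all $u\in R^\ast$. Given an ordered basis $B=(b_1,\dots,b_n)$ of the free left module $R^n$, put $V_0=\{0\}$ and $V_i=Rb_1+\dots+Rb_i$. The lexicographic order on $R^n$: if $x\in V_{i-1}$ and $y\in V_i\setminus V_{i-1}$ then $x<y$; if $x\ne y$ both lie in $V_i\setminus V_{i-1}$, write $x=\sum_{j\le i}x_jb_j$, $y=\sum_{j\le i}y_jb_j$, let $k$ be the largest index with $x_k\ne y_k$, and set $x<y$ iff $x_k<y_k$ in $R$. Fix a set $\Gamma\subseteq R$ containing one generator of each nonzero left ideal of $R$. Greedy algorithm: $C_0=\{0\}$; for $i=1,\dots,n$, let $a_i$ be the smallest vector of $V_i\setminus V_{i-1}$ (if any) such that $P[\gamma a_i+c]$ is true for all $\gamma\in\Gamma$ and all $c\in C_{i-1}$; if such $a_i$ exists set $C_i=Ra_i+C_{i-1}$, otherwise $C_i=C_{i-1}$. The lexicode is $C(<,B,P):=C_n$.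 *)

theory Defs
  imports Main "HOL-Library.Cardinality"
begin

text \<open>The ring R is a type of class ring_1 (ring with 1, 1 ~= 0); R^n is the
  type of functions 'n => 'a with 'n a finite index type, n = CARD('n).
  Left module structure: scalar multiplication on the left.\<close>

definition unit_of :: "'a::ring_1 \<Rightarrow> bool" where
  "unit_of u \<longleftrightarrow> (\<exists>v. u * v = 1 \<and> v * u = 1)"

definition left_ideal :: "'a::ring_1 set \<Rightarrow> bool" where
  "left_ideal I \<longleftrightarrow> 0 \<in> I \<and> (\<forall>x\<in>I. \<forall>y\<in>I. x + y \<in> I) \<and> (\<forall>r x. x \<in> I \<longrightarrow> r * x \<in> I)"

definition lgen :: "'a::ring_1 \<Rightarrow> 'a set" where
  "lgen x = range (\<lambda>r. r * x)"

definition principal_left_ideal_ring :: "'a::ring_1 itself \<Rightarrow> bool" where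
  "principal_left_ideal_ring _ \<longleftrightarrow> (\<forall>I::'a set. left_ideal I \<longrightarrow> (\<exists>a. I = lgen a))"

definition vzero :: "'n \<Rightarrow> 'a::ring_1" where
  "vzero = (\<lambda>j. 0)"

definition vadd :: "('n \<Rightarrow> 'a::ring_1) \<Rightarrow> ('n \<Rightarrow> 'a) \<Rightarrow> ('n \<Rightarrow> 'a)" where
  "vadd x y = (\<lambda>j. x j + y j)"

definition vsmult :: "'a::ring_1 \<Rightarrow> ('n \<Rightarrow> 'a) \<Rightarrow> ('n \<Rightarrow> 'a)" where
  "vsmult r x = (\<lambda>j. r * x j)"

definition vrmult :: "('n \<Rightarrow> 'a::ring_1) \<Rightarrow> 'a \<Rightarrow> ('n \<Rightarrow> 'a)" where
  "vrmult x r = (\<lambda>j. x j * r)"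

definition multiplicative :: "(('n::finite \<Rightarrow> 'a::ring_1) \<Rightarrow> bool) \<Rightarrow> bool" where
  "multiplicative P \<longleftrightarrow>
     (\<forall>u x. unit_of u \<longrightarrow> P (vsmult u x) = P x \<and> P (vrmult x u) = P x)"

definition lincomb :: "(nat \<Rightarrow> 'a::ring_1) \<Rightarrow> (nat \<Rightarrow> ('n \<Rightarrow> 'a)) \<Rightarrow> nat \<Rightarrow> ('n \<Rightarrow> 'a)" where
  "lincomb c b k = (\<lambda>j. \<Sum>i\<in>{1..k}. c i * b i j)"

definition Vspan :: "(nat \<Rightarrow> ('n \<Rightarrow> 'a::ring_1)) \<Rightarrow> nat \<Rightarrow> ('n \<Rightarrow> 'a) set" where
  "Vspan b k = {lincomb c b k | c. True}"

definition lin_indep :: "(nat \<Rightarrow> ('n \<Rightarrow> 'a::ring_1)) \<Rightarrow> nat \<Rightarrow> bool" where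
  "lin_indep b k \<longleftrightarrow> (\<forall>c. lincomb c b k = vzero \<longrightarrow> (\<forall>i\<in>{1..k}. c i = 0))"

definition ordered_basis :: "(nat \<Rightarrow> ('n::finite \<Rightarrow> 'a::ring_1)) \<Rightarrow> bool" where
  "ordered_basis b \<longleftrightarrow> Vspan b CARD('n) = UNIV \<and> lin_indep b CARD('n)"

definition left_submodule :: "('n \<Rightarrow> 'a::ring_1) set \<Rightarrow> bool" where
  "left_submodule C \<longleftrightarrow> vzero \<in> C \<and> (\<forall>x\<in>C. \<forall>y\<in>C. vadd x y \<in> C) \<and>
     (\<forall>r. \<forall>x\<in>C. vsmult r x \<in> C)"

definition free_submodule :: "('n \<Rightarrow> 'a::ring_1) set \<Rightarrow> bool" where
  "free_submodule C \<longleftrightarrow> left_submodule C \<and>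
     (\<exists>m g. (\<forall>i\<in>{1..m}. g i \<in> C) \<and> C = Vspan g m \<and> lin_indep g m)"

definition strict_total_order :: "('a \<Rightarrow> 'a \<Rightarrow> bool) \<Rightarrow> bool" where
  "strict_total_order lt \<longleftrightarrow> (\<forall>x. \<not> lt x x) \<and>
     (\<forall>x y z. lt x y \<longrightarrow> lt y z \<longrightarrow> lt x z) \<and>
     (\<forall>x y. x \<noteq> y \<longrightarrow> lt x y \<or> lt y x)"

definition respectful_order :: "('a::ring_1 \<Rightarrow> 'a \<Rightarrow> bool) \<Rightarrow> bool" where
  "respectful_order lt \<longleftrightarrow> strict_total_order lt \<and>
     (\<forall>x y. x \<noteq> 0 \<longrightarrow> y \<noteq> 0 \<longrightarrow> lgen y \<subset> lgen x \<longrightarrow>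
        (\<exists>\<alpha>. unit_of \<alpha> \<and> (\<forall>u. unit_of u \<longrightarrow> lt (\<alpha> * x) (u * y))))"

definition coord :: "(nat \<Rightarrow> ('n::finite \<Rightarrow> 'a::ring_1)) \<Rightarrow> ('n \<Rightarrow> 'a) \<Rightarrow> nat \<Rightarrow> 'a" where
  "coord b x = (THE c. (\<forall>i. i \<notin> {1..CARD('n)} \<longrightarrow> c i = 0) \<and> x = lincomb c b CARD('n))"

definition lexless :: "('a::ring_1 \<Rightarrow> 'a \<Rightarrow> bool) \<Rightarrow> (nat \<Rightarrow> ('n::finite \<Rightarrow> 'a))
    \<Rightarrow> ('n \<Rightarrow> 'a) \<Rightarrow> ('n \<Rightarrow> 'a) \<Rightarrow> bool" where
  "lexless lt b x y \<longleftrightarrow>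
     (\<exists>i\<in>{1..CARD('n)}. x \<in> Vspan b (i - 1) \<and> y \<in> Vspan b i - Vspan b (i - 1)) \<or>
     (\<exists>i\<in>{1..CARD('n)}. x \<noteq> y \<and> x \<in> Vspan b i - Vspan b (i - 1) \<and>
        y \<in> Vspan b i - Vspan b (i - 1) \<and>
        (let k = (GREATEST k. k \<le> i \<and> coord b x k \<noteq> coord b y k)
         in lt (coord b x k) (coord b y k)))"

definition lexmin :: "('a::ring_1 \<Rightarrow> 'a \<Rightarrow> bool) \<Rightarrow> (nat \<Rightarrow> ('n::finite \<Rightarrow> 'a))
    \<Rightarrow> ('n \<Rightarrow> 'a) set \<Rightarrow> ('n \<Rightarrow> 'a)" where
  "lexmin lt b S = (THE a. a \<in> S \<and> (\<forall>y\<in>S. y \<noteq> a \<longrightarrow> lexless lt b a y))"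

definition gamma_set :: "'a::ring_1 set \<Rightarrow> bool" where
  "gamma_set \<Gamma> \<longleftrightarrow> (\<forall>\<gamma>\<in>\<Gamma>. \<gamma> \<noteq> 0) \<and>
     (\<forall>I. left_ideal I \<and> I \<noteq> {0} \<longrightarrow> (\<exists>!\<gamma>. \<gamma> \<in> \<Gamma> \<and> lgen \<gamma> = I))"

primrec greedy :: "('a::ring_1 \<Rightarrow> 'a \<Rightarrow> bool) \<Rightarrow> (nat \<Rightarrow> ('n::finite \<Rightarrow> 'a))
    \<Rightarrow> (('n \<Rightarrow> 'a) \<Rightarrow> bool) \<Rightarrow> 'a set \<Rightarrow> nat \<Rightarrow> ('n \<Rightarrow> 'a) set" where
  "greedy lt b P \<Gamma> 0 = {vzero}"
| "greedy lt b P \<Gamma> (Suc i) =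
     (let S = {a \<in> Vspan b (Suc i) - Vspan b i.
                 \<forall>\<gamma>\<in>\<Gamma>. \<forall>c\<in>greedy lt b P \<Gamma> i. P (vadd (vsmult \<gamma> a) c)}
      in if S = {} then greedy lt b P \<Gamma> i
         else {vadd (vsmult r (lexmin lt b S)) c | r c. c \<in> greedy lt b P \<Gamma> i})"

definition lexicode :: "('a::ring_1 \<Rightarrow> 'a \<Rightarrow> bool) \<Rightarrow> (nat \<Rightarrow> ('n::finite \<Rightarrow> 'a))
    \<Rightarrow> (('n \<Rightarrow> 'a) \<Rightarrow> bool) \<Rightarrow> 'a set \<Rightarrow> ('n \<Rightarrow> 'a) set" where
  "lexicode lt b P \<Gamma> = greedy lt b P \<Gamma> CARD('n)"

end

theory Submission
  imports Defs "HOL-Library.FuncSet"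
begin

text \<open>If the first \<open>m\<close> basis vectors generate \<open>C\<close> and the order on \<open>R\<close> starts with \<open>0 < 1\<close>, then
  step \<open>i \<le> m\<close> of the greedy algorithm selects \<open>b\<^sub>i\<close> itself, so that \<open>C\<^sub>m = V\<^sub>m = C\<close>. It remains
  to extend a free basis of \<open>C\<close> to one of \<open>R\<^sup>n\<close>, one vector at a time. The coefficients \<open>c\<^sub>j\<close> of the
  next vector at the basis vectors not yet exchanged have no common left annihilator. In a finite
  principal left ideal ring every maximal right ideal has a nonzero left annihilator, so the \<open>c\<^sub>j\<close>
  generate \<open>R\<close> as a right ideal; as finite rings have stable range one, a change of basis
  turns the first of them into a unit.\<close>

subsection \<open>One-sided and prime ideals of a finite ring\<close>

text \<open>Principality on the left enters through two-sided ideals: each has a generator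
  \<open>b\<close> with \<open>b R \<subseteq> R b\<close>. For a maximal right ideal
  \<open>M\<close> the annihilator \<open>A\<close> of the simple module \<open>R / M\<close> is
  prime, and the zero ideal contains a product of primes. Normal generators allow these factors to
  be reordered into \<open>w * p^k = 0\<close> with \<open>A = R p\<close> and
  \<open>w \<notin> A\<close>, and the last nonzero \<open>w * p^j\<close> kills \<open>A\<close>
  from the left. It need not kill \<open>M\<close>; the transfer to \<open>M\<close> uses that
  simple modules with annihilator \<open>A\<close> are isomorphic. This and stable range one rest on
  finite prime rings being simple. Statements about \<open>R / A\<close> are phrased as congruences
  modulo \<open>A\<close>, and simple modules occur as \<open>T / A\<close>. A common left
  annihilator \<open>z\<close> of the \<open>c_j\<close> would make \<open>z\<close> times the new
  vector a combination of the earlier ones, against independence. That \<open>1\<close> can directly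
  follow \<open>0\<close> in a respectful order is due to \<open>R 1 = R\<close> being the largest
  left ideal.\<close>

definition right_ideal :: "'a::ring_1 set \<Rightarrow> bool" where
  "right_ideal I \<longleftrightarrow> 0 \<in> I \<and> (\<forall>x\<in>I. \<forall>y\<in>I. x + y \<in> I) \<and> (\<forall>x\<in>I. \<forall>r. x * r \<in> I)"

definition two_sided_ideal :: "'a::ring_1 set \<Rightarrow> bool" where
  "two_sided_ideal I \<longleftrightarrow> right_ideal I \<and> (\<forall>x\<in>I. \<forall>r. r * x \<in> I)"

text \<open>Primeness is that of ideals, tested on \<open>x R y\<close>; testing single products
  \<open>x * y\<close> would exclude the zero ideal of a matrix ring.\<close>

definition prime_ideal :: "'a::ring_1 set \<Rightarrow> bool" where
  "prime_ideal A \<longleftrightarrow> two_sided_ideal A \<and> 1 \<notin> A \<and>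
     (\<forall>x y. (\<forall>r. x * r * y \<in> A) \<longrightarrow> x \<in> A \<or> y \<in> A)"

definition maximal_right_ideal :: "'a::ring_1 set \<Rightarrow> bool" where
  "maximal_right_ideal M \<longleftrightarrow> right_ideal M \<and> 1 \<notin> M \<and>
     (\<forall>I. right_ideal I \<longrightarrow> M \<subset> I \<longrightarrow> 1 \<in> I)"

text \<open>Encodes a simple right module \<open>T / A\<close> without forming a quotient.\<close>

definition minimal_right_ideal_over :: "'a::ring_1 set \<Rightarrow> 'a set \<Rightarrow> bool" where
  "minimal_right_ideal_over A T \<longleftrightarrow> right_ideal T \<and> A \<subset> T \<and>
     (\<forall>I. right_ideal I \<longrightarrow> A \<subseteq> I \<longrightarrow> I \<subseteq> T \<longrightarrow> I = A \<or> I = T)"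

lemma right_idealD:
  assumes "right_ideal I"
  shows "0 \<in> I" "\<And>x y. x \<in> I \<Longrightarrow> y \<in> I \<Longrightarrow> x + y \<in> I" "\<And>x r. x \<in> I \<Longrightarrow> x * r \<in> I"
    "\<And>x. x \<in> I \<Longrightarrow> - x \<in> I" "\<And>x y. x \<in> I \<Longrightarrow> y \<in> I \<Longrightarrow> x - y \<in> I"
proof -
  show z: "0 \<in> I" and p: "\<And>x y. x \<in> I \<Longrightarrow> y \<in> I \<Longrightarrow> x + y \<in> I"
    and m: "\<And>x r. x \<in> I \<Longrightarrow> x * r \<in> I"
    using assms unfolding right_ideal_def by auto
  show n: "- x \<in> I" if "x \<in> I" for x using m[OF that, of "-1"] by simp
  show "x - y \<in> I" if "x \<in> I" "y \<in> I" for x y using p[OF that(1) n[OF that(2)]] by simp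
qed

lemma two_sided_idealD:
  assumes "two_sided_ideal I"
  shows "right_ideal I" "left_ideal I" "\<And>x r. x \<in> I \<Longrightarrow> r * x \<in> I"
  using assms unfolding two_sided_ideal_def left_ideal_def right_ideal_def by auto

lemma prime_idealD:
  assumes "prime_ideal A"
  shows "two_sided_ideal A" "right_ideal A" "1 \<notin> A"
    "\<And>x y. (\<And>r. x * r * y \<in> A) \<Longrightarrow> x \<in> A \<or> y \<in> A"
  using assms two_sided_idealD unfolding prime_ideal_def by blast+

lemma right_ideal_image_add:
  assumes I: "right_ideal I" and A: "right_ideal A"
  shows "right_ideal {x * i + a |i a. i \<in> I \<and> a \<in> A}"
proof -
  have "\<exists>i' a'. 0 = x * i' + a' \<and> i' \<in> I \<and> a' \<in> A"
    using right_idealD(1)[OF I] right_idealD(1)[OF A] by (intro exI[of _ 0]) auto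
  moreover have "\<exists>i' a'. (x * i + a) + (x * j + b) = x * i' + a' \<and> i' \<in> I \<and> a' \<in> A"
    if "i \<in> I" "a \<in> A" "j \<in> I" "b \<in> A" for i a j b
    using right_idealD(2)[OF I that(1,3)] right_idealD(2)[OF A that(2,4)]
    by (intro exI[of _ "i + j"] exI[of _ "a + b"]) (auto simp: algebra_simps)
  moreover have "\<exists>i' a'. (x * i + a) * r = x * i' + a' \<and> i' \<in> I \<and> a' \<in> A"
    if "i \<in> I" "a \<in> A" for i a r
    using right_idealD(3)[OF I that(1), of r] right_idealD(3)[OF A that(2), of r]
    by (intro exI[of _ "i * r"] exI[of _ "a * r"]) (auto simp: algebra_simps)
  ultimately show ?thesis unfolding right_ideal_def by blast
qed

lemma right_ideal_UNIV: "right_ideal UNIV"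
  unfolding right_ideal_def by auto

lemma right_ideal_vimage_mult:
  assumes I: "right_ideal I" and A: "right_ideal A"
  shows "right_ideal {s \<in> I. x * s \<in> A}"
  using right_idealD(1-3)[OF I] right_idealD(1-3)[OF A]
  unfolding right_ideal_def by (auto simp: distrib_left mult.assoc[symmetric])

lemma exists_maximal_right_ideal:
  fixes I :: "'a::{ring_1,finite} set"
  assumes "right_ideal I" "1 \<notin> I"
  obtains M where "maximal_right_ideal M" "I \<subseteq> M"
proof -
  define F where "F = {M. right_ideal M \<and> 1 \<notin> M \<and> I \<subseteq> M}"
  have "finite F" by (rule finite)
  moreover have "I \<in> F" using assms unfolding F_def by simp
  ultimately obtain M where M: "M \<in> F" "\<forall>N\<in>F. M \<subseteq> N \<longrightarrow> M = N"
    using finite_has_maximal2[of F I] by auto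
  have "maximal_right_ideal M"
    unfolding maximal_right_ideal_def
  proof (intro conjI allI impI)
    show "right_ideal M" "1 \<notin> M" using M(1) unfolding F_def by simp_all
    show "1 \<in> N" if "right_ideal N" "M \<subset> N" for N
      using M that unfolding F_def by auto
  qed
  then show ?thesis using that M(1) unfolding F_def by simp
qed

lemma exists_minimal_right_ideal_over:
  fixes A :: "'a::{ring_1,finite} set"
  assumes "right_ideal X" "A \<subset> X"
  obtains T where "minimal_right_ideal_over A T" "T \<subseteq> X"
proof -
  define F where "F = {T. right_ideal T \<and> A \<subset> T \<and> T \<subseteq> X}"
  have "finite F" by (rule finite)
  moreover have "X \<in> F" using assms unfolding F_def by simp
  ultimately obtain T where T: "T \<in> F" "\<forall>N\<in>F. N \<subseteq> T \<longrightarrow> T = N"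
    using finite_has_minimal2[of F X] by auto
  have "minimal_right_ideal_over A T"
    unfolding minimal_right_ideal_over_def
  proof (intro conjI allI impI)
    show "right_ideal T" "A \<subset> T" using T(1) unfolding F_def by simp_all
    show "I = A \<or> I = T" if "right_ideal I" "A \<subseteq> I" "I \<subseteq> T" for I
      using T that unfolding F_def by auto
  qed
  then show ?thesis using that T(1) unfolding F_def by simp
qed

section \<open>Schur's lemma for right ideals\<close>

text \<open>\<open>x I + A\<close> lies between \<open>A\<close> and \<open>T\<close> and contains
  \<open>x * i\<close>, so simplicity of \<open>T / A\<close> forces it to be \<open>T\<close>: the
  surjective half of Schur's lemma.\<close>

lemma minimal_right_ideal_over_image:
  assumes T: "minimal_right_ideal_over A T" and A: "right_ideal A" and I: "right_ideal I"
    and sub: "\<And>i. i \<in> I \<Longrightarrow> x * i \<in> T" and i: "i \<in> I" "x * i \<notin> A" and t: "t \<in> T"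
  obtains j where "j \<in> I" "t - x * j \<in> A"
proof -
  define N where "N = {x * i + a |i a. i \<in> I \<and> a \<in> A}"
  have rT: "right_ideal T" and AT: "A \<subset> T"
    and min: "\<And>I. right_ideal I \<Longrightarrow> A \<subseteq> I \<Longrightarrow> I \<subseteq> T \<Longrightarrow> I = A \<or> I = T"
    using T unfolding minimal_right_ideal_over_def by auto
  have mem: "x * i + a \<in> N" if "i \<in> I" "a \<in> A" for i a
    using that unfolding N_def by auto
  have "a \<in> N" if "a \<in> A" for a using mem[OF right_idealD(1)[OF I] that] by simp
  moreover have "N \<subseteq> T"
    using sub AT right_idealD(2)[OF rT] unfolding N_def by auto
  moreover have "right_ideal N" unfolding N_def by (rule right_ideal_image_add[OF I A])
  ultimately have "N = A \<or> N = T" using min by (simp add: subsetI)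
  moreover have "x * i \<in> N" using mem[OF i(1) right_idealD(1)[OF A]] by simp
  ultimately have "t \<in> N" using i(2) t by auto
  then obtain j a where "j \<in> I" "a \<in> A" "t = x * j + a" unfolding N_def by auto
  then show ?thesis using that by simp
qed

lemma maximal_right_ideal_inverse:
  assumes M: "maximal_right_ideal M" and x: "x \<notin> M"
  obtains i where "1 - x * i \<in> M"
proof -
  define N where "N = {x * i + m |i m. i \<in> UNIV \<and> m \<in> M}"
  have rM: "right_ideal M" and max: "\<And>I. right_ideal I \<Longrightarrow> M \<subset> I \<Longrightarrow> 1 \<in> I"
    using M unfolding maximal_right_ideal_def by auto
  have mem: "x * i + m \<in> N" if "m \<in> M" for i m
    using that unfolding N_def by auto
  have "m \<in> N" if "m \<in> M" for m using mem[OF that, of 0] by simp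
  moreover have "x \<in> N" using mem[OF right_idealD(1)[OF rM], of 1] by simp
  ultimately have "M \<subset> N" using x by auto
  moreover have "right_ideal N"
    unfolding N_def by (rule right_ideal_image_add[OF right_ideal_UNIV rM])
  ultimately have "1 \<in> N" using max by simp
  then obtain i m where im: "1 = x * i + m" "m \<in> M" unfolding N_def by auto
  have "1 - x * i = m" using im(1) by (simp add: algebra_simps)
  then show ?thesis using that[of i] im(2) by simp
qed

text \<open>Left multiplication by \<open>x\<close> induces a homomorphism from \<open>T / A\<close>
  to \<open>R / M\<close>; being nonzero at \<open>t\<close>, it is injective.\<close>

lemma minimal_right_ideal_over_kernel:
  assumes T: "minimal_right_ideal_over A T" and M: "right_ideal M"
    and A: "\<And>a. a \<in> A \<Longrightarrow> x * a \<in> M" and t: "t \<in> T" "x * t \<notin> M"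
    and s: "s \<in> T" "x * s \<in> M"
  shows "s \<in> A"
proof -
  have rT: "right_ideal T" using T unfolding minimal_right_ideal_over_def by blast
  let ?N = "{s \<in> T. x * s \<in> M}"
  have "right_ideal ?N" "A \<subseteq> ?N" "?N \<subseteq> T" "?N \<noteq> T"
    using right_ideal_vimage_mult[OF rT M, of x] A t T unfolding minimal_right_ideal_over_def by auto
  then have "?N = A" using T unfolding minimal_right_ideal_over_def by metis
  then show ?thesis using s by blast
qed

section \<open>Cancellation and inverses in finite rings\<close>

lemma power_cycle:
  fixes x :: "'a::{ring_1,finite}"
  obtains i d where "d > 0" "x ^ i * (1 - x ^ d) = 0"
proof -
  have "\<not> inj (\<lambda>n::nat. x ^ n)"
    using finite_imageD[of "\<lambda>n::nat. x ^ n" UNIV] infinite_UNIV_nat finite by blast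
  then obtain i j where "x ^ i = x ^ j" "i \<noteq> j" unfolding inj_def by blast
  then obtain i j where "x ^ i = x ^ j" "i < j" by (metis nat_neq_iff)
  then have "x ^ i = x ^ i * x ^ (j - i)"
    by (metis power_add le_add_diff_inverse less_imp_le)
  then have "x ^ i * (1 - x ^ (j - i)) = 0" by (simp add: right_diff_distrib)
  then show ?thesis using that \<open>i < j\<close> by (metis zero_less_diff)
qed

text \<open>Cancelling \<open>x ^ i\<close> from \<open>x ^ i * (1 - x ^ d) = 0\<close> modulo
  \<open>A\<close> leaves \<open>x ^ d = 1\<close>, so \<open>x ^ (d - 1)\<close> inverts
  \<open>x\<close>.\<close>

lemma left_regular_imp_right_inverse:
  fixes A :: "'a::{ring_1,finite} set"
  assumes "two_sided_ideal A" and reg: "\<And>s. x * s \<in> A \<Longrightarrow> s \<in> A"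
  obtains y where "x * y - 1 \<in> A"
proof -
  have A: "right_ideal A" using assms two_sided_idealD by blast
  obtain i d where d: "d > 0" "x ^ i * (1 - x ^ d) = 0" by (rule power_cycle)
  have "x ^ i * s \<in> A \<Longrightarrow> s \<in> A" for s
    by (induction i) (auto simp: mult.assoc intro: reg)
  then have "1 - x ^ d \<in> A" using d(2) right_idealD(1)[OF A] by metis
  then have "x ^ d - 1 \<in> A" using right_idealD(4)[OF A] by fastforce
  then show ?thesis using that[of "x ^ (d - 1)"] d(1) by (simp add: power_Suc[symmetric] del: power_Suc)
qed

text \<open>A left inverse modulo \<open>B\<close> makes \<open>x\<close> left cancellable, hence by
  finiteness right invertible modulo \<open>B\<close>; the right inverse then cancels
  \<open>x\<close> in \<open>r * x\<close>.\<close>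

lemma left_inverse_imp_right_regular:
  fixes B :: "'a::{ring_1,finite} set"
  assumes B: "two_sided_ideal B" and y: "y * x - 1 \<in> B" and r: "r * x \<in> B"
  shows "r \<in> B"
proof -
  note rB = two_sided_idealD(1)[OF B] and lm = two_sided_idealD(3)[OF B]
  have "s \<in> B" if "x * s \<in> B" for s
  proof -
    have "y * (x * s) - (y * x - 1) * s \<in> B"
      using that y rB lm right_idealD by metis
    then show ?thesis by (simp add: algebra_simps)
  qed
  then obtain z where "x * z - 1 \<in> B" using left_regular_imp_right_inverse[OF B] by metis
  then have "(r * x) * z - r * (x * z - 1) \<in> B" using r rB lm right_idealD by metis
  then show ?thesis by (simp add: algebra_simps)
qed

lemma unit_of_right_inverse:
  fixes x :: "'a::{ring_1,finite}"
  assumes "x * y = 1"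
  shows "unit_of x"
proof -
  have B: "two_sided_ideal {0::'a}" unfolding two_sided_ideal_def right_ideal_def by auto
  have "(y * x - 1) * y = 0" using assms by (simp add: algebra_simps)
  \<comment> \<open>The roles are swapped: \<open>x\<close> is a left inverse of \<open>y\<close>,
    so \<open>y\<close> may be cancelled on the right of \<open>y * x - 1\<close>.\<close>
  then have "y * x - 1 \<in> {0}"
    using left_inverse_imp_right_regular[OF B, of x y "y * x - 1"] assms by simp
  then show ?thesis using assms unfolding unit_of_def by auto
qed

section \<open>Prime ideals of a finite ring\<close>

text \<open>Each \<open>r\<close> is matched by some \<open>b \<in> B\<close> acting alike on
  \<open>T / A\<close>. By primeness only elements of \<open>A\<close> annihilate
  \<open>T / A\<close>, so \<open>r - b \<in> A\<close>.\<close>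

lemma prime_ideal_maximal:
  fixes A :: "'a::{ring_1,finite} set"
  assumes A: "prime_ideal A" and B: "two_sided_ideal B" "A \<subset> B"
  shows "B = UNIV"
proof -
  note rA = prime_idealD(2)[OF A] and tA = prime_idealD(1)[OF A]
  note rB = two_sided_idealD(1)[OF B(1)]
  obtain T where T: "minimal_right_ideal_over A T"
    using exists_minimal_right_ideal_over[OF rB B(2)] by blast
  have rT: "right_ideal T" using T unfolding minimal_right_ideal_over_def by blast
  obtain b0 where b0: "b0 \<in> B" "b0 \<notin> A" using B by blast
  \<comment> \<open>The kernels of \<open>r \<mapsto> (t * r)\<close>, \<open>t \<in> S\<close>, modulo \<open>A\<close> form a chain from \<open>R\<close> down to \<open>A\<close> whose factors
    are zero or isomorphic to the simple module \<open>T / A\<close>, and \<open>B\<close> annihilates none of the latter.\<close>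
  have "\<exists>b\<in>B. \<forall>t\<in>S. t * (r - b) \<in> A" if "finite S" "S \<subseteq> T" for S r
    using that
  proof (induction S)
    case empty
    then show ?case using b0 by blast
  next
    case (insert t S)
    then obtain b where b: "b \<in> B" "\<forall>t\<in>S. t * (r - b) \<in> A" by auto
    let ?K = "{x. \<forall>t\<in>S. t * x \<in> A} \<inter> B"
    show ?case
    proof (cases "t * (r - b) \<in> A")
      case True
      then show ?thesis using b by blast
    next
      case False
      \<comment> \<open>Since \<open>b\<close> agrees with \<open>r\<close> on \<open>S\<close>, the
        element \<open>(r - b) * q * b0\<close> lies in \<open>?K\<close>, while \<open>t\<close>
        does not kill it. Hence \<open>t ?K + A = T\<close>, and some \<open>k \<in> ?K\<close>
        corrects \<open>b\<close> at \<open>t\<close> without disturbing \<open>S\<close>.\<close>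
      then obtain q where q: "t * (r - b) * q * b0 \<notin> A" using prime_idealD(4)[OF A] b0 by blast
      have K: "right_ideal ?K"
        using right_idealD(1-3)[OF rB] right_idealD(1-3)[OF rA]
        unfolding right_ideal_def by (auto simp: distrib_left mult.assoc[symmetric])
      have "(r - b) * q * b0 \<in> ?K"
        using b b0 two_sided_idealD(3)[OF B(1)] right_idealD(3)[OF rA]
        by (auto simp: mult.assoc[symmetric])
      then obtain k where k: "k \<in> ?K" "t * (r - b) - t * k \<in> A"
        using minimal_right_ideal_over_image[OF T rA K, of t "(r - b) * q * b0" "t * (r - b)"]
          q insert.prems right_idealD(3)[OF rT] by (auto simp: mult.assoc)
      have "t' * (r - (b + k)) \<in> A" if "t' \<in> insert t S" for t'
        using that k b right_idealD(5)[OF rA, of "t' * (r - b)" "t' * k"]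
        by (auto simp: algebra_simps)
      then show ?thesis using right_idealD(2)[OF rB b(1), of k] k by blast
    qed
  qed
  then have ex: "\<exists>b\<in>B. \<forall>t\<in>T. t * (r - b) \<in> A" for r using finite[of T] by blast
  have "r \<in> B" for r
  proof -
    obtain b where b: "b \<in> B" "\<forall>t\<in>T. t * (r - b) \<in> A" using ex by blast
    obtain t where t: "t \<in> T" "t \<notin> A" using T unfolding minimal_right_ideal_over_def by blast
    have "t * q * (r - b) \<in> A" for q using b(2) right_idealD(3)[OF rT t(1)] by blast
    then have "r - b \<in> A" using prime_idealD(4)[OF A] t(2) by blast
    then have "(r - b) + b \<in> B" using B(2) b(1) right_idealD(2)[OF rB] by blast
    then show ?thesis by simp
  qed
  then show ?thesis by blast
qed

text \<open>The elements that \<open>z R\<close> sends into \<open>I\<close> form a two-sided ideal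
  containing \<open>A\<close>; with \<open>e\<close> in it, maximality of \<open>A\<close> would
  make it \<open>R\<close> and put \<open>z\<close> into \<open>I\<close>.\<close>

lemma prime_ideal_act:
  fixes A :: "'a::{ring_1,finite} set"
  assumes A: "prime_ideal A" and I: "right_ideal I" and zA: "\<And>a. a \<in> A \<Longrightarrow> z * a \<in> I"
    and z: "z \<notin> I" and e: "e \<notin> A"
  obtains r where "z * r * e \<notin> I"
proof (rule ccontr)
  assume "\<not> thesis"
  then have con: "\<forall>r. z * r * e \<in> I" using that by metis
  let ?K = "{x. \<forall>r. z * r * x \<in> I}"
  have "right_ideal ?K"
    unfolding right_ideal_def using right_idealD(1-3)[OF I]
    by (auto simp: distrib_left mult.assoc[symmetric])
  moreover have "z * r * (s * x) \<in> I" if "x \<in> ?K" for r s x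
  proof -
    have "z * (r * s) * x \<in> I" using that by blast
    then show ?thesis by (simp add: mult.assoc)
  qed
  ultimately have "two_sided_ideal ?K" unfolding two_sided_ideal_def by blast
  moreover have "A \<subseteq> ?K"
    using zA two_sided_idealD(3)[OF prime_idealD(1)[OF A]] by (auto simp: mult.assoc)
  ultimately have "?K = UNIV" using prime_ideal_maximal[OF A] con e by blast
  then have "z * 1 * 1 \<in> I" by blast
  then show False using z by simp
qed

text \<open>Brauer's lemma modulo \<open>A\<close>: by primeness some \<open>p \<in> T\<close> acts
  on \<open>T / A\<close> nontrivially, hence bijectively. Solving \<open>p * e = p\<close> and
  cancelling \<open>p\<close> from \<open>p * (e * e - e)\<close> gives the idempotent.\<close>

lemma minimal_right_ideal_over_idempotent:
  fixes A :: "'a::{ring_1,finite} set"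
  assumes A: "prime_ideal A" and T: "minimal_right_ideal_over A T"
  obtains e where "e \<in> T" "e \<notin> A" "e * e - e \<in> A"
proof -
  note rA = prime_idealD(2)[OF A] and lm = two_sided_idealD(3)[OF prime_idealD(1)[OF A]]
  have rT: "right_ideal T" using T unfolding minimal_right_ideal_over_def by blast
  obtain s where s0: "s \<in> T" "s \<notin> A" using T unfolding minimal_right_ideal_over_def by blast
  obtain q where q: "s * q * s \<notin> A" using prime_idealD(4)[OF A] s0(2) by blast
  define p where "p = s * q"
  have p: "p \<in> T" "p \<notin> A" and s: "s \<in> T" "p * s \<notin> A"
    using s0 q right_idealD(3)[OF rT] right_idealD(3)[OF rA] unfolding p_def by auto
  then obtain e where e: "e \<in> T" "p - p * e \<in> A"
    using minimal_right_ideal_over_image[OF T rA rT, of p s p] p right_idealD(3)[OF rT] by blast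
  have "- ((p - p * e) * e) \<in> A" using right_idealD(3,4)[OF rA] e by blast
  then have "p * (e * e - e) \<in> A" by (simp add: algebra_simps)
  moreover have "e * e - e \<in> T" using e right_idealD[OF rT] by blast
  ultimately have "e * e - e \<in> A"
    using minimal_right_ideal_over_kernel[OF T rA lm s] by blast
  moreover have "e \<notin> A"
  proof
    assume "e \<in> A"
    then have "(p - p * e) + p * e \<in> A" using e lm right_idealD(2)[OF rA] by blast
    then show False using p by simp
  qed
  ultimately show ?thesis using that e(1) by blast
qed

text \<open>The set is the annihilator of the simple right module \<open>R / M\<close>. If
  \<open>r * x\<close> is outside \<open>M\<close>, it generates \<open>R / M\<close>, so
  \<open>y\<close> kills everything once \<open>x R y\<close> does.\<close>

lemma annihilator_maximal_right_ideal_prime: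
  fixes M :: "'a::ring_1 set"
  assumes M: "maximal_right_ideal M"
  shows "prime_ideal {x. \<forall>r. r * x \<in> M}" (is "prime_ideal ?A")
proof -
  have rM: "right_ideal M" and one: "1 \<notin> M" using M unfolding maximal_right_ideal_def by auto
  have ts: "two_sided_ideal ?A"
    unfolding two_sided_ideal_def right_ideal_def using right_idealD(1-3)[OF rM]
    by (auto simp: distrib_left mult.assoc[symmetric])
  have "x \<in> ?A \<or> y \<in> ?A" if xy: "\<forall>r. x * r * y \<in> ?A" for x y
  proof (rule disjCI)
    assume "y \<notin> ?A"
    then obtain q where q: "q * y \<notin> M" by blast
    show "x \<in> ?A"
    proof (rule ccontr)
      assume "x \<notin> ?A"
      then obtain r where r: "r * x \<notin> M" by blast
      obtain i where i: "1 - (r * x) * i \<in> M" by (rule maximal_right_ideal_inverse[OF M r])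
      define m where "m = 1 - (r * x) * i"
      have im: "1 = (r * x) * i + m" "m \<in> M" using i unfolding m_def by simp_all
      have "q * y = (r * x * i + m) * (q * y)" using im(1) by simp
      also have "\<dots> = r * (x * (i * q) * y) + m * (q * y)" by (simp add: algebra_simps)
      also have "\<dots> \<in> M" using xy im(2) right_idealD(2,3)[OF rM] by blast
      finally show False using q by blast
    qed
  qed
  moreover have "1 \<notin> ?A" using one by (metis (mono_tags, lifting) mem_Collect_eq mult_1)
  ultimately show ?thesis using ts unfolding prime_ideal_def by blast
qed

lemma prime_ideal_not_subset:
  fixes A :: "'a::{ring_1,finite} set"
  assumes "prime_ideal A" "prime_ideal B" "B \<noteq> A"
  shows "\<not> B \<subseteq> A"
  using prime_ideal_maximal[OF assms(2) prime_idealD(1)[OF assms(1)]]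
    prime_idealD(3)[OF assms(1)] assms(3) by auto

lemma prime_ideal_comaximal:
  fixes A :: "'a::{ring_1,finite} set"
  assumes A: "prime_ideal A" and B: "two_sided_ideal B" "\<not> B \<subseteq> A"
  obtains b where "b \<in> B" "b - 1 \<in> A"
proof -
  define N where "N = {1 * b + a |b a. b \<in> B \<and> a \<in> A}"
  note rA = prime_idealD(2)[OF A] and lA = two_sided_idealD(3)[OF prime_idealD(1)[OF A]]
  note rB = two_sided_idealD(1)[OF B(1)] and lB = two_sided_idealD(3)[OF B(1)]
  have mem: "1 * b + a \<in> N" if "b \<in> B" "a \<in> A" for b a
    using that unfolding N_def by blast
  have "right_ideal N" unfolding N_def by (rule right_ideal_image_add[OF rB rA])
  moreover have "r * x \<in> N" if xN: "x \<in> N" for r x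
  proof -
    obtain b a where "b \<in> B" "a \<in> A" "x = 1 * b + a" using xN unfolding N_def by blast
    then show ?thesis using mem[OF lB[of b r] lA[of a r]] by (simp add: distrib_left)
  qed
  ultimately have "two_sided_ideal N" unfolding two_sided_ideal_def by simp
  moreover have "a \<in> N" if "a \<in> A" for a using mem[OF right_idealD(1)[OF rB] that] by simp
  moreover have "b \<in> N" if "b \<in> B" for b using mem[OF that right_idealD(1)[OF rA]] by simp
  ultimately have "N = UNIV" using prime_ideal_maximal[OF A] B(2) by blast
  then obtain b a where ba: "b \<in> B" "a \<in> A" "1 = 1 * b + a" unfolding N_def by blast
  have "b - 1 = - a" using ba(3) by (simp add: algebra_simps)
  then show ?thesis using that ba(1,2) right_idealD(4)[OF rA] by simp
qed

text \<open>Chinese remaindering: each of the finitely many other primes contains an element that is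
  \<open>1\<close> modulo \<open>A\<close>, and \<open>w\<close> is their product.\<close>

lemma prime_ideal_separating_element:
  fixes A :: "'a::{ring_1,finite} set"
  assumes A: "prime_ideal A"
  obtains w where "w - 1 \<in> A" "\<And>B. prime_ideal B \<Longrightarrow> B \<noteq> A \<Longrightarrow> w \<in> B"
proof -
  note rA = prime_idealD(2)[OF A] and lA = two_sided_idealD(3)[OF prime_idealD(1)[OF A]]
  have ex: "\<exists>w. w - 1 \<in> A \<and> (\<forall>B\<in>S. w \<in> B)" if "finite S" "\<forall>B\<in>S. prime_ideal B \<and> B \<noteq> A" for S
    using that
  proof (induction S)
    case empty
    then show ?case using right_idealD(1)[OF rA] by (intro exI[of _ 1]) simp
  next
    case (insert B S)
    then obtain w where w: "w - 1 \<in> A" "\<forall>B\<in>S. w \<in> B" by auto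
    have B: "prime_ideal B" "B \<noteq> A" using insert.prems by auto
    obtain b where b: "b \<in> B" "b - 1 \<in> A"
      using prime_ideal_comaximal[OF A prime_idealD(1)[OF B(1)] prime_ideal_not_subset[OF A B]]
      by auto
    have "w * (b - 1) + (w - 1) \<in> A" using right_idealD(2)[OF rA lA[OF b(2)] w(1)] .
    then have "w * b - 1 \<in> A" by (simp add: algebra_simps)
    moreover have "w * b \<in> B" using two_sided_idealD(3)[OF prime_idealD(1)[OF B(1)] b(1)] .
    moreover have "w * b \<in> B'" if "B' \<in> S" for B'
      using w(2) insert.prems that prime_idealD(2) right_idealD(3) by (metis insert_iff)
    ultimately show ?case by blast
  qed
  define S where "S = {B. prime_ideal B \<and> B \<noteq> A}"
  have "\<forall>B\<in>S. prime_ideal B \<and> B \<noteq> A" unfolding S_def by simp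
  then obtain w where w: "w - 1 \<in> A" "\<forall>B\<in>S. w \<in> B" using ex[OF finite] by blast
  show ?thesis using that[OF w(1)] w(2) unfolding S_def by simp
qed

text \<open>Choose \<open>t \<in> I\<close> with \<open>x = a + t\<close> maximising the total size of the right ideals \<open>x R + A\<close> over all
  primes \<open>A\<close>. If \<open>x\<close> is not a unit, some \<open>x R + A\<close> is proper; then \<open>x\<close> kills an idempotent \<open>e\<close>
  modulo \<open>A\<close>, and adding to \<open>x\<close> an element of \<open>I\<close> supported on \<open>e\<close> and vanishing modulo all other
  primes enlarges \<open>x R + A\<close> only.\<close>
lemma stable_range_one:
  fixes a :: "'a::{ring_1,finite}"
  assumes I: "right_ideal I" and i: "1 - a * r \<in> I"
  obtains t where "t \<in> I" "unit_of (a + t)"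
proof -
  define N where "N x A = {x * s + b |s b. s \<in> UNIV \<and> b \<in> A}" for x :: 'a and A
  define PR where "PR = {A :: 'a set. prime_ideal A}"
  define \<mu> where "\<mu> t = (\<Sum>A\<in>PR. card (N (a + t) A))" for t
  have finPR: "finite PR" by (rule finite)
  have fin\<mu>: "finite (\<mu> ` I)" by simp
  moreover have "\<mu> ` I \<noteq> {}" using right_idealD(1)[OF I] by auto
  ultimately have "Max (\<mu> ` I) \<in> \<mu> ` I" by (rule Max_in)
  then obtain t where t: "t \<in> I" "Max (\<mu> ` I) = \<mu> t" by auto
  have tmax: "\<mu> t' \<le> \<mu> t" if "t' \<in> I" for t'
    using Max_ge[OF fin\<mu>, of "\<mu> t'"] that t(2) by simp
  note t = t(1)
  define x where "x = a + t"
  have "\<exists>y. x * y = 1"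
  proof (rule ccontr)
    assume no: "\<not> (\<exists>y. x * y = 1)"
    have "right_ideal (range (\<lambda>s. x * s))"
      unfolding right_ideal_def by (auto simp: image_iff mult.assoc distrib_left[symmetric])
        (metis mult_zero_right)
    moreover have "1 \<notin> range (\<lambda>s. x * s)" using no by (metis rangeE)
    ultimately obtain M where M: "maximal_right_ideal M" and xM: "range (\<lambda>s. x * s) \<subseteq> M"
      using exists_maximal_right_ideal by metis
    have rM: "right_ideal M" and oneM: "1 \<notin> M" using M unfolding maximal_right_ideal_def by auto
    define A where "A = {q. \<forall>r. r * q \<in> M}"
    have A: "prime_ideal A"
      unfolding A_def by (rule annihilator_maximal_right_ideal_prime[OF M])
    note rA = prime_idealD(2)[OF A] and tA = prime_idealD(1)[OF A]
    note lA = two_sided_idealD(3)[OF tA]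
    have AM: "q \<in> M" if "q \<in> A" for q
    proof -
      have "1 * q \<in> M" using that unfolding A_def by blast
      then show ?thesis by simp
    qed
    define X where "X = {s \<in> UNIV. x * s \<in> A}"
    have rX: "right_ideal X" unfolding X_def by (rule right_ideal_vimage_mult[OF right_ideal_UNIV rA])
    \<comment> \<open>If \<open>x\<close> were cancellable modulo \<open>A\<close>, it would have a
      right inverse modulo \<open>A \<subseteq> M\<close>, which \<open>x R \<subseteq> M\<close>
      forbids.\<close>
    have "\<exists>s. x * s \<in> A \<and> s \<notin> A"
    proof (rule ccontr)
      assume "\<not> ?thesis"
      then obtain y where "x * y - 1 \<in> A" using left_regular_imp_right_inverse[OF tA] by metis
      then have "x * y - (x * y - 1) \<in> M" using right_idealD(5)[OF rM _ AM] xM by blast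
      then show False using oneM by simp
    qed
    then have "A \<subset> X" using lA unfolding X_def by auto
    then obtain T where T: "minimal_right_ideal_over A T" "T \<subseteq> X"
      by (rule exists_minimal_right_ideal_over[OF rX])
    obtain e where e: "e \<in> T" "e \<notin> A" "e * e - e \<in> A"
      by (rule minimal_right_ideal_over_idempotent[OF A T(1)])
    have xe: "x * e \<in> A" using e T(2) unfolding X_def by auto
    \<comment> \<open>This is \<open>1 - x * r\<close>, an element of \<open>I\<close> outside
      \<open>M\<close>; it supplies the part of \<open>I\<close> that \<open>x R + A\<close>
      misses.\<close>
    define y where "y = (1 - a * r) - t * r"
    have yI: "y \<in> I" unfolding y_def using i right_idealD(3,5)[OF I] t by metis
    have "1 = x * r + y" unfolding x_def y_def by (simp add: algebra_simps)
    then have "y \<notin> M" using xM oneM right_idealD(2)[OF rM, of "x * r" y] by auto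
    then obtain p where p: "y * p * e \<notin> M"
      using prime_ideal_act[OF A rM _ _ e(2), of y] unfolding A_def by auto
    obtain w where w: "w - 1 \<in> A" "\<And>B. prime_ideal B \<Longrightarrow> B \<noteq> A \<Longrightarrow> w \<in> B"
      using prime_ideal_separating_element[OF A] by metis
    define u where "u = y * p * e"
    have uA: "u * e - u \<in> A"
    proof -
      have "(y * p) * (e * e - e) \<in> A" using lA e(3) by blast
      then show ?thesis unfolding u_def by (simp add: algebra_simps)
    qed
    have uw: "u * w - u \<in> A"
    proof -
      have "u * (w - 1) \<in> A" using lA w(1) by blast
      then show ?thesis by (simp add: algebra_simps)
    qed
    define t' where "t' = t + u * w"
    have t'I: "t' \<in> I"
      unfolding t'_def u_def using yI t right_idealD(2,3)[OF I] by metis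
    have mono: "N (a + t) B \<subseteq> N (a + t') B" if "B \<in> PR" for B
    proof -
      have pB: "prime_ideal B" using that unfolding PR_def by simp
      note rB = prime_idealD(2)[OF pB] and lB = two_sided_idealD(3)[OF prime_idealD(1)[OF pB]]
      have "\<exists>s'. (a + t) * s - (a + t') * s' \<in> B" for s
      proof (cases "B = A")
        case False
        then have "u * w * s \<in> B" using w(2) that lB right_idealD(3)[OF rB] unfolding PR_def by blast
        then have "- (u * w * s) \<in> B" using right_idealD(4)[OF rB] by blast
        then show ?thesis unfolding t'_def by (intro exI[of _ s]) (simp add: algebra_simps)
      next
        case True
        \<comment> \<open>Modulo \<open>A\<close>, \<open>x * e = 0\<close> and
          \<open>u * w * e = u * e = u = u * w\<close>. So the added \<open>u * w\<close> vanishes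
          on \<open>s - e * s\<close>, where \<open>x\<close> takes the same value as on
          \<open>s\<close>.\<close>
        have 1: "(x * e) * s - ((u * w - u) * s - (u * w - u) * (e * s)) + (u * e - u) * s \<in> A"
          using right_idealD[OF rA] xe uw uA by meson
        have "(a + t) * s - (a + t') * (s - e * s)
          = (x * e) * s - ((u * w - u) * s - (u * w - u) * (e * s)) + (u * e - u) * s"
          unfolding x_def t'_def by (simp add: algebra_simps)
        then show ?thesis using 1 True by metis
      qed
      then have "\<exists>s'. \<exists>b'\<in>B. (a + t) * s + b = (a + t') * s' + b'" if "b \<in> B" for s b
        using right_idealD(2)[OF rB _ that] by (metis add.commute add_diff_cancel_left' diff_add_eq diff_diff_eq2 add_diff_eq)
      then show ?thesis unfolding N_def by blast
    qed
    \<comment> \<open>Strict growth at \<open>A\<close>: modulo \<open>A\<close>, \<open>u\<close>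
      is \<open>(a + t') * e\<close>, whereas \<open>x R + A \<subseteq> M\<close> misses
      \<open>u\<close>.\<close>
    have "u \<in> N (a + t') A"
    proof -
      have "- (x * e) - (u * w - u) * e - (u * e - u) \<in> A"
        using right_idealD[OF rA] xe uw uA by meson
      moreover have "u = (a + t') * e + (- (x * e) - (u * w - u) * e - (u * e - u))"
        unfolding x_def t'_def by (simp add: algebra_simps)
      ultimately show ?thesis unfolding N_def by blast
    qed
    moreover have "u \<notin> N (a + t) A"
    proof
      assume "u \<in> N (a + t) A"
      then obtain s b where "u = x * s + b" "b \<in> A" unfolding N_def x_def by blast
      then have "u \<in> M" using xM AM right_idealD(2)[OF rM, of "x * s" b] by auto
      then show False using p unfolding u_def by simp
    qed
    moreover have "A \<in> PR" using A unfolding PR_def by simp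
    ultimately have "card (N (a + t) A) < card (N (a + t') A)"
      using mono[of A] by (intro psubset_card_mono) auto
    then have "\<mu> t < \<mu> t'"
      unfolding \<mu>_def using \<open>A \<in> PR\<close> card_mono[OF finite mono] finPR
      by (intro sum_strict_mono_ex1) auto
    then show False using tmax[OF t'I] by simp
  qed
  then show ?thesis using that[OF t] unit_of_right_inverse unfolding x_def by blast
qed

subsection \<open>Annihilators in principal left ideal rings\<close>

text \<open>In a principal left ideal ring the two-sided ideals are the sets \<open>R x\<close> with \<open>x R \<subseteq> R x\<close>, and
  \<open>(R x) (R y) = R (x * y)\<close>; working with the generators avoids ideal products.\<close>
definition normal_elem :: "'a::ring_1 \<Rightarrow> bool" where
  "normal_elem x \<longleftrightarrow> (\<forall>r. \<exists>s. x * r = s * x)"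

lemma normal_elem_mult: "normal_elem x \<Longrightarrow> normal_elem y \<Longrightarrow> normal_elem (x * y)"
  unfolding normal_elem_def by (metis mult.assoc)

lemma normal_elem_one: "normal_elem 1"
  unfolding normal_elem_def by simp

lemma normal_elem_power: "normal_elem x \<Longrightarrow> normal_elem (x ^ k)"
  by (induction k) (auto simp: normal_elem_one intro: normal_elem_mult)

lemma lgen_mult_mem: "r * x \<in> lgen x"
  unfolding lgen_def by simp

lemma lgen_self: "x \<in> lgen x"
  using lgen_mult_mem[of 1 x] by simp

lemma two_sided_ideal_lgen:
  assumes "normal_elem x"
  shows "two_sided_ideal (lgen x)"
proof -
  have "\<exists>r'. r * x * s = r' * x" for r s
    using assms unfolding normal_elem_def by (metis mult.assoc)
  moreover have "\<exists>r. 0 = r * x" by (rule exI[of _ 0]) simp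
  ultimately show ?thesis
    unfolding two_sided_ideal_def right_ideal_def lgen_def
    by (auto simp: image_iff distrib_right[symmetric] mult.assoc[symmetric])
qed

lemma two_sided_ideal_principal:
  fixes B :: "'a::ring_1 set"
  assumes "principal_left_ideal_ring TYPE('a)" "two_sided_ideal B"
  obtains b where "normal_elem b" "B = lgen b"
proof -
  obtain b where b: "B = lgen b"
    using assms two_sided_idealD(2) unfolding principal_left_ideal_ring_def by blast
  have "b * r \<in> lgen b" for r
    using right_idealD(3)[OF two_sided_idealD(1)[OF assms(2)]] lgen_self[of b] b by simp
  then have "normal_elem b" unfolding normal_elem_def lgen_def by blast
  then show ?thesis using that b by blast
qed

text \<open>Modulo \<open>R p^k\<close> the element \<open>w\<close> is a unit, so \<open>R w \<inter> R p^k = R p^k w\<close>.\<close>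
lemma normal_elem_comaximal_power:
  fixes p :: "'a::{ring_1,finite}"
  assumes p: "normal_elem p" and A: "prime_ideal (lgen p)" and w: "normal_elem w" "w \<notin> lgen p"
  obtains s where "w * p ^ k = s * p ^ k * w"
proof -
  obtain b where b: "b \<in> lgen w" "b - 1 \<in> lgen p"
    using prime_ideal_comaximal[OF A two_sided_ideal_lgen[OF w(1)]] lgen_self[of w] w(2) by blast
  obtain y0 q where y0: "b = y0 * w" "b - 1 = q * p" using b unfolding lgen_def by blast
  have "\<exists>y. y * w - 1 \<in> lgen (p ^ k)"
  proof (induction k)
    case 0
    then show ?case using lgen_mult_mem[of "- 1" 1] by (intro exI[of _ 0]) simp
  next
    case (Suc k)
    then obtain y r where y: "y * w - 1 = r * p ^ k" unfolding lgen_def by blast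
    obtain q' where q': "p ^ k * q = q' * p ^ k"
      using normal_elem_power[OF p] unfolding normal_elem_def by metis
    \<comment> \<open>Lifting an inverse from \<open>p ^ k\<close> to \<open>p ^ Suc k\<close>:
      subtracting the error \<open>r * p ^ k\<close> times \<open>y0\<close> leaves the error
      \<open>- r * p ^ k * (b - 1)\<close>, and \<open>b - 1\<close> supplies one more factor
      \<open>p\<close>.\<close>
    have "(y - r * p ^ k * y0) * w - 1 = r * p ^ k - r * p ^ k * (y0 * w)"
      using y by (simp add: algebra_simps)
    also have "\<dots> = - (r * (p ^ k * (b - 1)))" using y0(1) by (simp add: algebra_simps)
    also have "\<dots> = - (r * ((p ^ k * q) * p))" unfolding y0(2) by (simp add: mult.assoc)
    also have "\<dots> = (- r * q') * p ^ Suc k"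
      unfolding q' power_Suc2 by (simp add: mult.assoc)
    finally show ?case using lgen_mult_mem by metis
  qed
  then obtain y where y: "y * w - 1 \<in> lgen (p ^ k)" ..
  have tk: "two_sided_ideal (lgen (p ^ k))"
    by (rule two_sided_ideal_lgen[OF normal_elem_power[OF p]])
  obtain s' where s': "w * p ^ k = s' * w" using w(1) unfolding normal_elem_def by blast
  have "s' * w \<in> lgen (p ^ k)" using lgen_mult_mem[of w "p ^ k"] s' by simp
  then have "s' \<in> lgen (p ^ k)" by (rule left_inverse_imp_right_regular[OF tk y])
  then show ?thesis using that s' unfolding lgen_def by auto
qed

text \<open>Every ideal of a finite ring contains a product of primes, since a proper non-prime one
  contains a product of two larger ideals. Primes other than \<open>R p\<close> have generators
  outside \<open>R p\<close>; moving the powers of \<open>p\<close> to the right collects these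
  generators in \<open>w\<close>.\<close>

lemma prime_ideal_power_in_ideal:
  fixes p :: "'a::{ring_1,finite}"
  assumes R: "principal_left_ideal_ring TYPE('a)"
    and p: "normal_elem p" and A: "prime_ideal (lgen p)" and B: "two_sided_ideal B"
  shows "\<exists>w k. normal_elem w \<and> w \<notin> lgen p \<and> w * p ^ k \<in> B"
  using B
proof (induction "card (- B)" arbitrary: B rule: less_induct)
  case less
  note rB = two_sided_idealD(1)[OF less.prems] and lB = two_sided_idealD(3)[OF less.prems]
  consider "1 \<in> B" | "B = lgen p" | "prime_ideal B" "B \<noteq> lgen p" | "\<not> prime_ideal B" "1 \<notin> B"
    by blast
  then show ?case
  proof cases
    case 1
    then show ?thesis using normal_elem_one prime_idealD(3)[OF A]
      by (intro exI[of _ 1] exI[of _ 0]) simp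
  next
    case 2
    then show ?thesis using normal_elem_one prime_idealD(3)[OF A] lgen_self[of p]
      by (intro exI[of _ 1]) simp
  next
    case 3
    obtain b where b: "normal_elem b" "B = lgen b"
      by (rule two_sided_ideal_principal[OF R less.prems])
    have "b \<notin> lgen p"
      using prime_ideal_not_subset[OF A 3] two_sided_idealD(3)[OF prime_idealD(1)[OF A], of b]
      unfolding b(2) lgen_def[of b] by blast
    then show ?thesis using b lgen_self[of b] by (intro exI[of _ b] exI[of _ 0]) simp
  next
    case 4
    then obtain x y where xy: "\<forall>r. x * r * y \<in> B" "x \<notin> B" "y \<notin> B"
      using less.prems unfolding prime_ideal_def by blast
    \<comment> \<open>Two ideals with \<open>B1 B2 \<subseteq> B\<close>, strictly larger than
      \<open>B\<close> because of \<open>x \<in> B1\<close> and \<open>y \<in> B2\<close>. The bound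
      \<open>p\<close> is not the generator \<open>p\<close>.\<close>
    define B1 where "B1 = {p. \<forall>r. p * r * y \<in> B}"
    define B2 where "B2 = {q. \<forall>p\<in>B1. p * q \<in> B}"
    have B1r: "a * r \<in> B1" if "a \<in> B1" for a r
    proof -
      have "a * (r * r') * y \<in> B" for r' using that unfolding B1_def by blast
      then show ?thesis unfolding B1_def by (simp add: mult.assoc)
    qed
    have B1l: "r * a \<in> B1" if "a \<in> B1" for a r
    proof -
      have "r * (a * r' * y) \<in> B" for r' using that lB unfolding B1_def by blast
      then show ?thesis unfolding B1_def by (simp add: mult.assoc)
    qed
    have "0 \<in> B1" "\<And>a b. a \<in> B1 \<Longrightarrow> b \<in> B1 \<Longrightarrow> a + b \<in> B1"
      using right_idealD(1,2)[OF rB] unfolding B1_def by (auto simp: distrib_right)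
    then have B1: "two_sided_ideal B1"
      unfolding two_sided_ideal_def right_ideal_def using B1r B1l by blast
    have B2: "two_sided_ideal B2"
      unfolding two_sided_ideal_def right_ideal_def B2_def
      using right_idealD(1-3)[OF rB] B1r by (auto simp: distrib_left mult.assoc[symmetric])
    have "B \<subset> B1"
      using xy right_idealD(3)[OF rB] unfolding B1_def by blast
    then have c1: "card (- B1) < card (- B)" by (intro psubset_card_mono) auto
    have "p * y \<in> B" if "p \<in> B1" for p
    proof -
      have "p * 1 * y \<in> B" using that unfolding B1_def by blast
      then show ?thesis by simp
    qed
    then have "y \<in> B2" unfolding B2_def by blast
    then have "B \<subset> B2" using xy lB unfolding B2_def by blast
    then have c2: "card (- B2) < card (- B)" by (intro psubset_card_mono) auto
    obtain w1 k1 where w1: "normal_elem w1" "w1 \<notin> lgen p" "w1 * p ^ k1 \<in> B1"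
      using less.hyps[OF c1 B1] by blast
    obtain w2 k2 where w2: "normal_elem w2" "w2 \<notin> lgen p" "w2 * p ^ k2 \<in> B2"
      using less.hyps[OF c2 B2] by blast
    obtain s where s: "w2 * p ^ k1 = s * p ^ k1 * w2"
      using normal_elem_comaximal_power[OF p A w2(1,2)] .
    obtain s' where s': "w1 * s = s' * w1" using w1(1) unfolding normal_elem_def by blast
    have "(w1 * w2) * p ^ (k1 + k2) = w1 * (w2 * p ^ k1) * p ^ k2"
      by (simp add: power_add mult.assoc)
    also have "\<dots> = (w1 * s) * p ^ k1 * w2 * p ^ k2" unfolding s by (simp add: mult.assoc)
    also have "\<dots> = s' * ((w1 * p ^ k1) * (w2 * p ^ k2))" unfolding s' by (simp add: mult.assoc)
    also have "\<dots> \<in> B" using w1(3) w2(3) lB unfolding B2_def by blast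
    finally have "(w1 * w2) * p ^ (k1 + k2) \<in> B" .
    \<comment> \<open>Normality of \<open>w1\<close> turns \<open>w1 R w2\<close> into left
      multiples of \<open>w1 * w2\<close>, so primeness applies to the single product.\<close>
    moreover have "w1 * w2 \<notin> lgen p"
    proof
      assume w12: "w1 * w2 \<in> lgen p"
      have "w1 * r * w2 \<in> lgen p" for r
      proof -
        obtain r' where "w1 * r = r' * w1" using w1(1) unfolding normal_elem_def by blast
        then have "w1 * r * w2 = r' * (w1 * w2)" by (simp add: mult.assoc)
        then show ?thesis using two_sided_idealD(3)[OF prime_idealD(1)[OF A] w12] by simp
      qed
      then show False using prime_idealD(4)[OF A] w1(2) w2(2) by blast
    qed
    ultimately show ?thesis using normal_elem_mult[OF w1(1) w2(1)] by blast
  qed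
qed

text \<open>For the least \<open>k\<close> with \<open>w * p ^ k = 0\<close>, the element
  \<open>w * p ^ (k - 1)\<close> is nonzero and kills \<open>p\<close>; its normality extends this
  to all of \<open>R p\<close>.\<close>

lemma prime_ideal_left_annihilator:
  fixes A :: "'a::{ring_1,finite} set"
  assumes R: "principal_left_ideal_ring TYPE('a)" and A: "prime_ideal A"
  obtains z where "z \<noteq> 0" "\<And>a. a \<in> A \<Longrightarrow> z * a = 0"
proof -
  obtain p where p: "normal_elem p" "A = lgen p"
    by (rule two_sided_ideal_principal[OF R prime_idealD(1)[OF A]])
  have "two_sided_ideal {0::'a}" unfolding two_sided_ideal_def right_ideal_def by auto
  then obtain w k where w: "normal_elem w" "w \<notin> A" "w * p ^ k = 0"
    using prime_ideal_power_in_ideal[OF R p(1)] A p(2) by blast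
  have "w \<noteq> 0" using w(2) right_idealD(1)[OF prime_idealD(2)[OF A]] by blast
  define k0 where "k0 = (LEAST k. w * p ^ k = 0)"
  have k0: "w * p ^ k0 = 0" unfolding k0_def using w(3) by (rule LeastI)
  have "k0 \<noteq> 0" using k0 \<open>w \<noteq> 0\<close> by (intro notI) simp
  then obtain j where j: "k0 = Suc j" using not0_implies_Suc by blast
  have "w * p ^ j \<noteq> 0" using not_less_Least[of j "\<lambda>k. w * p ^ k = 0"] j unfolding k0_def by simp
  moreover have "w * p ^ j * a = 0" if aA: "a \<in> A" for a
  proof -
    obtain r where r: "a = r * p" using aA p(2) unfolding lgen_def by auto
    obtain s where s: "w * p ^ j * r = s * (w * p ^ j)"
      using normal_elem_mult[OF w(1) normal_elem_power[OF p(1)]] unfolding normal_elem_def by blast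
    have "w * p ^ j * a = (w * p ^ j * r) * p" unfolding r by (simp add: mult.assoc)
    also have "\<dots> = s * (w * p ^ k0)" unfolding s j power_Suc2 by (simp add: mult.assoc)
    finally show ?thesis unfolding k0 by simp
  qed
  ultimately show ?thesis using that by blast
qed

text \<open>\<open>R / M\<close> embeds into \<open>R\<close> through \<open>T / A\<close>: left
  multiplication by \<open>m\<close> leads from \<open>R / M\<close> to \<open>T / A\<close>, and by
  \<open>z0 * r\<close> from \<open>T / A\<close> injectively into \<open>R\<close>. The image
  \<open>z0 * r * m\<close> of \<open>1\<close> kills \<open>M\<close>.\<close>

lemma maximal_right_ideal_left_annihilator:
  fixes M :: "'a::{ring_1,finite} set"
  assumes R: "principal_left_ideal_ring TYPE('a)" and M: "maximal_right_ideal M"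
  obtains z where "z \<noteq> 0" "\<And>x. x \<in> M \<Longrightarrow> z * x = 0"
proof -
  have rM: "right_ideal M" and oneM: "1 \<notin> M" using M unfolding maximal_right_ideal_def by auto
  define A where "A = {q. \<forall>r. r * q \<in> M}"
  have A: "prime_ideal A"
    unfolding A_def by (rule annihilator_maximal_right_ideal_prime[OF M])
  note lA = two_sided_idealD(3)[OF prime_idealD(1)[OF A]]
  have AM: "r * q \<in> M" if "q \<in> A" for r q using that unfolding A_def by blast
  have zero: "right_ideal {0::'a}" unfolding right_ideal_def by auto
  have "A \<subset> UNIV" using prime_idealD(3)[OF A] by blast
  then obtain T where T: "minimal_right_ideal_over A T"
    using exists_minimal_right_ideal_over[OF right_ideal_UNIV] by metis
  then have rT: "right_ideal T" unfolding minimal_right_ideal_over_def by simp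
  obtain e where e: "e \<in> T" "e \<notin> A" using T unfolding minimal_right_ideal_over_def by auto
  obtain t where t: "t * e \<notin> M"
    using prime_ideal_act[OF A rM AM oneM e(2)] by auto
  obtain i where i: "1 - (t * e) * i \<in> M" by (rule maximal_right_ideal_inverse[OF M t])
  \<comment> \<open>As \<open>t * m\<close> is \<open>1\<close> modulo \<open>M\<close>,
    \<open>m\<close> inverts the injection of \<open>T / A\<close> into \<open>R / M\<close> given
    by \<open>t\<close>; this is why it sends \<open>M\<close> into \<open>A\<close>.\<close>
  define m where "m = e * i"
  have mT: "m * x \<in> T" for x unfolding m_def using right_idealD(3)[OF rT] e(1) by metis
  have i': "1 - t * m \<in> M" using i unfolding m_def by (simp add: mult.assoc)
  have mA: "m \<notin> A"
  proof
    assume "m \<in> A"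
    then have "(1 - t * m) + t * m \<in> M" using right_idealD(2)[OF rM i' AM] by blast
    then show False using oneM by simp
  qed
  have mx: "m * x \<in> A" if "x \<in> M" for x
  proof -
    have "x - (1 - t * m) * x \<in> M" using right_idealD(3,5)[OF rM] i' that by metis
    then have "t * (m * x) \<in> M" by (simp add: algebra_simps)
    then show ?thesis
      using minimal_right_ideal_over_kernel[OF T rM _ e(1) t mT] AM by blast
  qed
  obtain z0 where z0: "z0 \<noteq> 0" "\<And>a. a \<in> A \<Longrightarrow> z0 * a = 0"
    using prime_ideal_left_annihilator[OF R A] by metis
  obtain r where r: "z0 * r * e \<notin> {0}"
    using prime_ideal_act[OF A zero _ _ e(2), of z0] z0 by auto
  have zA: "z0 * r * a \<in> {0}" if "a \<in> A" for a
    using z0(2)[OF lA[OF that, of r]] by (simp add: mult.assoc)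
  have "z0 * r * m \<noteq> 0"
    using minimal_right_ideal_over_kernel[OF T zero zA e(1) r, of m] mT[of 1] mA by auto
  moreover have "z0 * r * m * x = 0" if "x \<in> M" for x
    using zA[OF mx[OF that]] by (simp add: mult.assoc)
  ultimately show ?thesis using that by blast
qed

lemma right_ideal_left_annihilator_zero:
  fixes I :: "'a::{ring_1,finite} set"
  assumes R: "principal_left_ideal_ring TYPE('a)" and I: "right_ideal I"
    and ann: "\<And>z. (\<And>x. x \<in> I \<Longrightarrow> z * x = 0) \<Longrightarrow> z = 0"
  shows "1 \<in> I"
proof (rule ccontr)
  assume "1 \<notin> I"
  then obtain M where M: "maximal_right_ideal M" "I \<subseteq> M"
    by (rule exists_maximal_right_ideal[OF I])
  obtain z where "z \<noteq> 0" "\<And>x. x \<in> M \<Longrightarrow> z * x = 0"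
    using maximal_right_ideal_left_annihilator[OF R M(1)] by metis
  then show False using ann M(2) by blast
qed

subsection \<open>Extending a linearly independent family to a basis\<close>

lemma lincomb_0: "lincomb c b 0 = vzero"
  unfolding lincomb_def vzero_def by simp

lemma lincomb_Suc: "lincomb c b (Suc k) = vadd (lincomb c b k) (vsmult (c (Suc k)) (b (Suc k)))"
  unfolding lincomb_def vadd_def vsmult_def by simp

lemma lincomb_cong:
  assumes "\<And>i. i \<in> {1..k} \<Longrightarrow> c i = c' i \<and> b i = b' i"
  shows "lincomb c b k = lincomb c' b' k"
  unfolding lincomb_def using assms by (intro ext sum.cong) auto

lemma lincomb_extend:
  assumes "j \<le> k" "\<And>i. i \<in> {1..k} \<Longrightarrow> j < i \<Longrightarrow> c i = 0"
  shows "lincomb c b k = lincomb c b j"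
  unfolding lincomb_def using assms by (intro ext sum.mono_neutral_right) auto

lemma lincomb_single:
  assumes "i \<in> {1..k}"
  shows "lincomb (\<lambda>j. if j = i then 1 else 0) b k = b i"
proof
  fix x
  have "(\<Sum>j\<in>{1..k}. (if j = i then 1 else 0) * b j x) = (\<Sum>j\<in>{1..k}. if j = i then b j x else 0)"
    by (intro sum.cong) auto
  also have "\<dots> = b i x" using assms by simp
  finally show "lincomb (\<lambda>j. if j = i then 1 else 0) b k x = b i x" unfolding lincomb_def .
qed

lemma Vspan_basis: "i \<in> {1..k} \<Longrightarrow> b i \<in> Vspan b k"
  using lincomb_single[of i k b] unfolding Vspan_def by (metis (mono_tags, lifting) mem_Collect_eq)

lemma left_submodule_Vspan: "left_submodule (Vspan b k)"
proof -
  have mem: "lincomb c b k \<in> Vspan b k" for c unfolding Vspan_def by blast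
  have "vzero \<in> Vspan b k" using mem[of "\<lambda>i. 0"] unfolding lincomb_def vzero_def by simp
  moreover have "vadd (lincomb c b k) (lincomb d b k) = lincomb (\<lambda>i. c i + d i) b k" for c d
    unfolding lincomb_def vadd_def by (simp add: distrib_right sum.distrib)
  moreover have "vsmult r (lincomb c b k) = lincomb (\<lambda>i. r * c i) b k" for c r
    unfolding lincomb_def vsmult_def by (simp add: sum_distrib_left mult.assoc)
  ultimately have "vzero \<in> Vspan b k"
    "vadd (lincomb c b k) (lincomb d b k) \<in> Vspan b k" "vsmult r (lincomb c b k) \<in> Vspan b k"
    for c d r
    using mem by simp_all
  then show ?thesis unfolding left_submodule_def Vspan_def by blast
qed

lemma lincomb_in_submodule:
  assumes W: "left_submodule W" and "\<And>i. i \<in> {1..k} \<Longrightarrow> b i \<in> W"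
  shows "lincomb c b k \<in> W"
  using assms(2)
proof (induction k)
  case 0
  then show ?case using W unfolding lincomb_0 left_submodule_def by simp
next
  case (Suc k)
  then show ?case using W unfolding lincomb_Suc left_submodule_def by simp
qed

lemma Vspan_mono: "j \<le> k \<Longrightarrow> Vspan b j \<subseteq> Vspan b k"
  using lincomb_in_submodule[OF left_submodule_Vspan, of j b b k] Vspan_basis[of _ k b]
  unfolding Vspan_def[of b j] by auto

lemma lin_indep_mono:
  assumes ind: "lin_indep b k" and "j \<le> k"
  shows "lin_indep b j"
  unfolding lin_indep_def
proof (intro allI impI ballI)
  fix c i assume c: "lincomb c b j = vzero" and i: "i \<in> {1..j}"
  define c' where "c' i = (if i \<le> j then c i else 0)" for i
  have "lincomb c' b k = lincomb c' b j" using assms(2) by (intro lincomb_extend) (auto simp: c'_def)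
  also have "\<dots> = lincomb c b j" by (intro lincomb_cong) (auto simp: c'_def)
  finally have "\<forall>i\<in>{1..k}. c' i = 0" using ind c unfolding lin_indep_def by simp
  then show "c i = 0" using i assms(2) unfolding c'_def by force
qed

text \<open>There are as many coefficient families on \<open>{1..n}\<close> as vectors, so a
  surjective \<open>lincomb\<close> is injective. Coefficients are functions on all of
  \<open>nat\<close>; extensional restriction makes the families a finite set.\<close>

lemma spanning_imp_ordered_basis:
  fixes b :: "nat \<Rightarrow> ('n::finite \<Rightarrow> 'a::{ring_1,finite})"
  assumes span: "Vspan b CARD('n) = UNIV"
  shows "ordered_basis b"
proof -
  let ?N = "CARD('n)"
  let ?S = "{1..?N}"
  let ?F = "?S \<rightarrow>\<^sub>E (UNIV :: 'a set)"
  let ?f = "\<lambda>c. lincomb c b ?N"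
  have "x \<in> ?f ` ?F" for x
  proof -
    obtain c where "x = ?f c" using span unfolding Vspan_def by blast
    also have "\<dots> = ?f (restrict c ?S)" by (intro lincomb_cong) auto
    finally have "x = ?f (restrict c ?S)" .
    moreover have "restrict c ?S \<in> ?F" by simp
    ultimately show ?thesis by (rule image_eqI)
  qed
  then have "?f ` ?F = UNIV" by blast
  moreover have "card ?F = CARD('n \<Rightarrow> 'a)" by (simp add: card_PiE card_fun)
  moreover have "finite ?F" by (intro finite_PiE) simp_all
  ultimately have inj: "inj_on ?f ?F" by (intro eq_card_imp_inj_on) simp_all
  have "c i = 0" if "?f c = vzero" "i \<in> ?S" for c i
  proof -
    have "?f (restrict c ?S) = ?f c" by (intro lincomb_cong) auto
    also have "\<dots> = vzero" by (rule that(1))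
    also have "\<dots> = ?f (restrict (\<lambda>i. 0) ?S)"
      unfolding lincomb_def vzero_def by (intro ext) simp
    finally have "restrict c ?S = restrict (\<lambda>i. 0) ?S"
      by (rule inj_onD[OF inj]) simp_all
    then show ?thesis using that(2) by (metis restrict_apply')
  qed
  then show ?thesis using span unfolding ordered_basis_def lin_indep_def by blast
qed

lemma exists_ordered_basis: "\<exists>b :: nat \<Rightarrow> ('n::finite \<Rightarrow> 'a::{ring_1,finite}). ordered_basis b"
proof -
  obtain h where h: "bij_betw h {1..CARD('n)} (UNIV :: 'n set)"
    using ex_bij_betw_nat_finite_1[OF finite[of "UNIV :: 'n set"]] by blast
  define b :: "nat \<Rightarrow> 'n \<Rightarrow> 'a" where "b i = (\<lambda>j. if j = h i then 1 else 0)" for i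
  have "x = lincomb (\<lambda>i. x (h i)) b CARD('n)" for x
  proof
    fix j
    have "lincomb (\<lambda>i. x (h i)) b CARD('n) j = (\<Sum>i\<in>{1..CARD('n)}. (\<lambda>j'. x j' * (if j = j' then 1 else 0)) (h i))"
      unfolding lincomb_def b_def by simp
    also have "\<dots> = (\<Sum>j'\<in>UNIV. x j' * (if j = j' then 1 else 0))"
      by (rule sum.reindex_bij_betw[OF h])
    also have "\<dots> = (\<Sum>j'\<in>UNIV. if j = j' then x j' else 0)" by (intro sum.cong) auto
    also have "\<dots> = x j" by simp
    finally show "x j = lincomb (\<lambda>i. x (h i)) b CARD('n) j" by simp
  qed
  then have "Vspan b CARD('n) = UNIV" unfolding Vspan_def by blast
  then show ?thesis using spanning_imp_ordered_basis by blast
qed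

lemma right_ideal_sum: "right_ideal {\<Sum>j\<in>S. c j * t j |t. True}"
proof -
  have "\<exists>t. 0 = (\<Sum>j\<in>S. c j * t j)" by (rule exI[of _ "\<lambda>j. 0"]) simp
  moreover have "\<exists>t''. (\<Sum>j\<in>S. c j * t j) + (\<Sum>j\<in>S. c j * t' j) = (\<Sum>j\<in>S. c j * t'' j)" for t t'
    by (rule exI[of _ "\<lambda>j. t j + t' j"]) (simp add: distrib_left sum.distrib)
  moreover have "\<exists>t'. (\<Sum>j\<in>S. c j * t j) * r = (\<Sum>j\<in>S. c j * t' j)" for t r
    by (rule exI[of _ "\<lambda>j. t j * r"]) (simp add: sum_distrib_right mult.assoc)
  ultimately show ?thesis unfolding right_ideal_def by blast
qed

lemma sum_split_at:
  fixes f :: "nat \<Rightarrow> 'b::comm_monoid_add"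
  assumes "Suc k \<le> n"
  shows "sum f {1..n} = sum f {1..k} + (f (Suc k) + sum f {Suc (Suc k)..n})"
proof -
  have "{1..n} = {1..k} \<union> {Suc k..n}" using assms by auto
  then have "sum f {1..n} = sum f {1..k} + sum f {Suc k..n}" by (simp add: sum.union_disjoint)
  then show ?thesis using sum.atLeast_Suc_atMost[OF assms, of f] by simp
qed

text \<open>Replacing each later \<open>b i\<close> by \<open>b i - t i * b (Suc k)\<close> keeps
  the span and adds the sum of the \<open>c i * t i\<close> to the coefficient of
  \<open>g (Suc k)\<close> at \<open>b (Suc k)\<close>. Once that coefficient is a unit,
  \<open>g (Suc k)\<close> can take the place.\<close>

lemma ordered_basis_exchange:
  fixes b g :: "nat \<Rightarrow> ('n::finite \<Rightarrow> 'a::{ring_1,finite})"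
  assumes R: "principal_left_ideal_ring TYPE('a)" and b: "ordered_basis b"
    and bg: "\<And>i. i \<in> {1..k} \<Longrightarrow> b i = g i" and k: "k \<le> CARD('n)" and g: "lin_indep g (Suc k)"
  shows "\<exists>b'. ordered_basis b' \<and> (\<forall>i\<in>{1..Suc k}. b' i = g i) \<and> Suc k \<le> CARD('n)"
proof -
  define N where "N = CARD('n)"
  have span: "Vspan b N = UNIV" using b unfolding ordered_basis_def N_def by simp
  then obtain c where c: "g (Suc k) = lincomb c b N" unfolding Vspan_def by blast
  have "1 \<in> {\<Sum>j\<in>{Suc k..N}. c j * t j |t. True}"
  proof (rule right_ideal_left_annihilator_zero[OF R right_ideal_sum])
    fix z assume z: "\<And>x. x \<in> {\<Sum>j\<in>{Suc k..N}. c j * t j |t. True} \<Longrightarrow> z * x = 0"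
    have zc: "z * c i = 0" if i: "i \<in> {Suc k..N}" for i
    proof -
      have "(\<Sum>j\<in>{Suc k..N}. c j * (if j = i then 1 else 0)) = (\<Sum>j\<in>{Suc k..N}. if j = i then c j else 0)"
        by (intro sum.cong) auto
      also have "\<dots> = c i" using i by simp
      finally have "\<exists>t. c i = (\<Sum>j\<in>{Suc k..N}. c j * t j)"
        by (intro exI[of _ "\<lambda>j. if j = i then 1 else 0"]) (rule sym)
      then show ?thesis by (intro z) simp
    qed
    \<comment> \<open>As \<open>z\<close> kills the coefficients beyond \<open>k\<close>,
      \<open>z\<close> times \<open>g (Suc k)\<close> is a combination of the earlier
      \<open>g i\<close>; \<open>d\<close> records this relation.\<close>
    define d where "d i = (if i \<le> k then z * c i else - z)" for i
    have "lincomb d g (Suc k) = vzero"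
    proof
      fix j
      have "(\<Sum>i\<in>{1..k}. d i * g i j) = (\<Sum>i\<in>{1..k}. z * c i * b i j)"
        using bg by (intro sum.cong) (auto simp: d_def)
      also have "\<dots> = (\<Sum>i\<in>{1..N}. z * c i * b i j)"
        using zc k unfolding N_def by (intro sum.mono_neutral_left) auto
      also have "\<dots> = z * g (Suc k) j"
        unfolding c lincomb_def by (simp add: sum_distrib_left mult.assoc)
      finally show "lincomb d g (Suc k) j = vzero j"
        unfolding lincomb_def vzero_def by (simp add: d_def)
    qed
    then have "d (Suc k) = 0" using g unfolding lin_indep_def by simp
    then show "z = 0" unfolding d_def by simp
  qed
  then obtain h where "1 = (\<Sum>j\<in>{Suc k..N}. c j * h j)" by blast
  then have h: "(\<Sum>j\<in>{Suc k..N}. c j * h j) = 1" by (rule sym)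
  \<comment> \<open>An empty sum cannot equal \<open>1\<close>; this bounds the length of the
    independent family by \<open>CARD('n)\<close>.\<close>
  have kN: "Suc k \<le> N"
  proof (rule ccontr)
    assume "\<not> Suc k \<le> N"
    then show False using h by simp
  qed
  let ?J = "{\<Sum>j\<in>{Suc (Suc k)..N}. c j * t j |t. True}"
  have "1 - c (Suc k) * h (Suc k) = (\<Sum>j\<in>{Suc (Suc k)..N}. c j * h j)"
    using h sum.atLeast_Suc_atMost[OF kN, of "\<lambda>j. c j * h j"] by (simp add: algebra_simps)
  then have "1 - c (Suc k) * h (Suc k) \<in> ?J" by blast
  then obtain t0 where "t0 \<in> ?J" "unit_of (c (Suc k) + t0)"
    by (rule stable_range_one[OF right_ideal_sum])
  then obtain t where t: "unit_of (c (Suc k) + (\<Sum>j\<in>{Suc (Suc k)..N}. c j * t j))" by blast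
  then obtain v where v: "v * (c (Suc k) + (\<Sum>j\<in>{Suc (Suc k)..N}. c j * t j)) = 1"
    unfolding unit_of_def by blast
  define b' where "b' i = (if i \<le> k then b i else if i = Suc k then g i
    else vadd (b i) (vsmult (- t i) (b (Suc k))))" for i
  define W where "W = Vspan b' N"
  have W: "left_submodule W" unfolding W_def by (rule left_submodule_Vspan)
  have b'W: "b' i \<in> W" if "i \<in> {1..N}" for i unfolding W_def by (rule Vspan_basis[OF that])
  \<comment> \<open>These coefficients solve the expansion of \<open>g (Suc k)\<close> for
    \<open>b (Suc k)\<close> in terms of \<open>b'\<close>, up to the unit factor that
    \<open>v\<close> removes.\<close>
  define c' where "c' i = (if i = Suc k then 1 else - c i)" for i
  have "vsmult v (lincomb c' b' N) = b (Suc k)"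
  proof
    fix j
    have 1: "(\<Sum>i\<in>{1..k}. c' i * b' i j) = - (\<Sum>i\<in>{1..k}. c i * b i j)"
      unfolding sum_negf[symmetric] by (intro sum.cong) (auto simp: c'_def b'_def)
    have "(\<Sum>i\<in>{Suc (Suc k)..N}. c' i * b' i j)
      = (\<Sum>i\<in>{Suc (Suc k)..N}. c i * t i * b (Suc k) j - c i * b i j)"
      by (intro sum.cong) (auto simp: c'_def b'_def vadd_def vsmult_def algebra_simps)
    then have 2: "(\<Sum>i\<in>{Suc (Suc k)..N}. c' i * b' i j)
      = (\<Sum>i\<in>{Suc (Suc k)..N}. c i * t i) * b (Suc k) j - (\<Sum>i\<in>{Suc (Suc k)..N}. c i * b i j)"
      by (simp add: sum_subtractf sum_distrib_right)
    have 3: "g (Suc k) j = (\<Sum>i\<in>{1..k}. c i * b i j)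
        + (c (Suc k) * b (Suc k) j + (\<Sum>i\<in>{Suc (Suc k)..N}. c i * b i j))"
      unfolding c lincomb_def by (rule sum_split_at[OF kN])
    have "lincomb c' b' N j = (\<Sum>i\<in>{1..k}. c' i * b' i j)
        + (c' (Suc k) * b' (Suc k) j + (\<Sum>i\<in>{Suc (Suc k)..N}. c' i * b' i j))"
      unfolding lincomb_def by (rule sum_split_at[OF kN])
    also have "c' (Suc k) * b' (Suc k) j = g (Suc k) j" unfolding c'_def b'_def by simp
    finally have "lincomb c' b' N j
        = (c (Suc k) + (\<Sum>i\<in>{Suc (Suc k)..N}. c i * t i)) * b (Suc k) j"
      unfolding 1 2 3 by (simp add: distrib_right)
    then show "vsmult v (lincomb c' b' N) j = b (Suc k) j"
      unfolding vsmult_def using v by (metis mult.assoc mult_1)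
  qed
  moreover have "lincomb c' b' N \<in> W" by (rule lincomb_in_submodule[OF W b'W])
  ultimately have bk: "b (Suc k) \<in> W" using W unfolding left_submodule_def by metis
  have "b i \<in> W" if i: "i \<in> {1..N}" for i
  proof -
    consider "i \<le> k" | "i = Suc k" | "i > Suc k" by linarith
    then show ?thesis
    proof cases
      case 1
      then show ?thesis using b'W[OF i] unfolding b'_def by simp
    next
      case 2
      then show ?thesis using bk by simp
    next
      case 3
      have "b i = vadd (b' i) (vsmult (t i) (b (Suc k)))"
        using 3 unfolding b'_def vadd_def vsmult_def by auto
      then show ?thesis using W b'W[OF i] bk unfolding left_submodule_def by simp
    qed
  qed
  then have "lincomb a b N \<in> W" for a by (rule lincomb_in_submodule[OF W])
  then have "Vspan b N \<subseteq> W" unfolding Vspan_def by auto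
  then have "Vspan b' CARD('n) = UNIV" using span unfolding W_def N_def by auto
  then have "ordered_basis b'" by (rule spanning_imp_ordered_basis)
  moreover have "b' i = g i" if "i \<in> {1..Suc k}" for i
    using bg that unfolding b'_def by auto
  ultimately show ?thesis using kN unfolding N_def by blast
qed

lemma lin_indep_extends_to_ordered_basis:
  fixes g :: "nat \<Rightarrow> ('n::finite \<Rightarrow> 'a::{ring_1,finite})"
  assumes R: "principal_left_ideal_ring TYPE('a)" and g: "lin_indep g m"
  shows "\<exists>b. ordered_basis b \<and> (\<forall>i\<in>{1..m}. b i = g i) \<and> m \<le> CARD('n)"
  using g
proof (induction m)
  case 0
  then show ?case using exists_ordered_basis by auto
next
  case (Suc k)
  then obtain b where "ordered_basis b" "\<forall>i\<in>{1..k}. b i = g i" "k \<le> CARD('n)"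
    using lin_indep_mono[OF Suc.prems, of k] by auto
  then show ?case using ordered_basis_exchange[OF R _ _ _ Suc.prems] by blast
qed

subsection \<open>Coordinates and the greedy algorithm\<close>

lemma ordered_basis_unique:
  fixes b :: "nat \<Rightarrow> ('n::finite \<Rightarrow> 'a::ring_1)"
  assumes "ordered_basis b" "lincomb c b CARD('n) = lincomb d b CARD('n)" "i \<in> {1..CARD('n)}"
  shows "c i = d i"
proof -
  have "lincomb (\<lambda>i. c i - d i) b CARD('n) = vzero"
  proof
    fix j
    have "lincomb c b CARD('n) j = lincomb d b CARD('n) j" using assms(2) by simp
    then show "lincomb (\<lambda>i. c i - d i) b CARD('n) j = vzero j"
      unfolding lincomb_def vzero_def by (simp add: left_diff_distrib sum_subtractf)
  qed
  then have "c i - d i = 0" using assms(1,3) unfolding ordered_basis_def lin_indep_def by blast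
  then show ?thesis by simp
qed

lemma coord_lincomb:
  fixes b :: "nat \<Rightarrow> ('n::finite \<Rightarrow> 'a::ring_1)"
  assumes b: "ordered_basis b" and c: "\<And>i. i \<notin> {1..CARD('n)} \<Longrightarrow> c i = 0"
  shows "coord b (lincomb c b CARD('n)) = c"
  unfolding coord_def
proof (rule the_equality)
  show "(\<forall>i. i \<notin> {1..CARD('n)} \<longrightarrow> c i = 0) \<and> lincomb c b CARD('n) = lincomb c b CARD('n)"
    using c by simp
  fix d assume d: "(\<forall>i. i \<notin> {1..CARD('n)} \<longrightarrow> d i = 0) \<and> lincomb c b CARD('n) = lincomb d b CARD('n)"
  show "d = c"
  proof
    fix i
    show "d i = c i"
      using ordered_basis_unique[OF b, of d c i] c[of i] d by (cases "i \<in> {1..CARD('n)}") auto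
  qed
qed

lemma lincomb_coord:
  fixes b :: "nat \<Rightarrow> ('n::finite \<Rightarrow> 'a::ring_1)"
  assumes b: "ordered_basis b"
  shows "lincomb (coord b x) b CARD('n) = x" "i \<notin> {1..CARD('n)} \<Longrightarrow> coord b x i = 0"
proof -
  obtain c where c: "x = lincomb c b CARD('n)"
    using b unfolding ordered_basis_def Vspan_def by blast
  define d where "d i = (if i \<in> {1..CARD('n)} then c i else 0)" for i
  have x: "x = lincomb d b CARD('n)" unfolding c by (intro lincomb_cong) (auto simp: d_def)
  have "coord b x = d" unfolding x by (rule coord_lincomb[OF b]) (auto simp: d_def)
  then show "lincomb (coord b x) b CARD('n) = x" "i \<notin> {1..CARD('n)} \<Longrightarrow> coord b x i = 0"
    using x by (auto simp: d_def)
qed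

lemma Vspan_iff_coord:
  fixes b :: "nat \<Rightarrow> ('n::finite \<Rightarrow> 'a::ring_1)"
  assumes b: "ordered_basis b" and i: "i \<le> CARD('n)"
  shows "x \<in> Vspan b i \<longleftrightarrow> (\<forall>j>i. coord b x j = 0)"
proof
  assume "x \<in> Vspan b i"
  then obtain c where c: "x = lincomb c b i" unfolding Vspan_def by blast
  define d where "d j = (if j \<in> {1..i} then c j else 0)" for j
  have "lincomb d b CARD('n) = lincomb d b i"
    by (rule lincomb_extend[OF i]) (simp add: d_def)
  also have "\<dots> = x" unfolding c by (intro lincomb_cong) (auto simp: d_def)
  finally have "x = lincomb d b CARD('n)" by simp
  moreover have "coord b (lincomb d b CARD('n)) = d"
    by (rule coord_lincomb[OF b]) (use i in \<open>auto simp: d_def\<close>)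
  ultimately have "coord b x = d" by simp
  then show "\<forall>j>i. coord b x j = 0" by (simp add: d_def)
next
  assume "\<forall>j>i. coord b x j = 0"
  then have "lincomb (coord b x) b CARD('n) = lincomb (coord b x) b i"
    by (intro lincomb_extend[OF i]) simp
  then show "x \<in> Vspan b i" using lincomb_coord(1)[OF b, of x] unfolding Vspan_def by auto
qed

lemma coord_basis:
  fixes b :: "nat \<Rightarrow> ('n::finite \<Rightarrow> 'a::ring_1)"
  assumes b: "ordered_basis b" and i: "i \<in> {1..CARD('n)}"
  shows "coord b (b i) = (\<lambda>j. if j = i then 1 else 0)"
proof -
  have "coord b (lincomb (\<lambda>j. if j = i then 1 else 0) b CARD('n)) = (\<lambda>j. if j = i then 1 else 0)"
    by (rule coord_lincomb[OF b]) (use i in auto)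
  then show ?thesis using lincomb_single[OF i, of b] by simp
qed

section \<open>Least vectors in the lexicographic order\<close>

lemma lexless_iff:
  fixes b :: "nat \<Rightarrow> ('n::finite \<Rightarrow> 'a::ring_1)"
  assumes i: "i \<in> {1..CARD('n)}"
    and x: "x \<in> Vspan b i - Vspan b (i - 1)" and y: "y \<in> Vspan b i - Vspan b (i - 1)"
  shows "lexless lt b x y \<longleftrightarrow> x \<noteq> y \<and>
    (let k = (GREATEST k. k \<le> i \<and> coord b x k \<noteq> coord b y k) in lt (coord b x k) (coord b y k))"
proof -
  have level: "i' = i" if "i' \<in> {1..CARD('n)}" "x \<in> Vspan b i' - Vspan b (i' - 1)" for i'
  proof (rule ccontr)
    assume "i' \<noteq> i"
    then have "i' \<le> i - 1 \<or> i \<le> i' - 1" by linarith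
    then show False using Vspan_mono[of i' "i - 1" b] Vspan_mono[of i "i' - 1" b] x that by blast
  qed
  have "\<not> (x \<in> Vspan b (i' - 1) \<and> y \<in> Vspan b i' - Vspan b (i' - 1))" for i'
  proof -
    have "i' - 1 \<le> i - 1 \<or> i \<le> i' - 1" by linarith
    then show ?thesis using Vspan_mono[of "i' - 1" "i - 1" b] Vspan_mono[of i "i' - 1" b] x y by blast
  qed
  then show ?thesis using level i x y unfolding lexless_def by blast
qed

text \<open>The definite description needs uniqueness: the index \<open>k\<close> of comparison is
  symmetric in the two vectors, so two least elements would be related by \<open>lt\<close> both
  ways.\<close>

lemma lexmin_eqI:
  fixes b :: "nat \<Rightarrow> ('n::finite \<Rightarrow> 'a::ring_1)"
  assumes lt: "strict_total_order lt" and i: "i \<in> {1..CARD('n)}"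
    and S: "S \<subseteq> Vspan b i - Vspan b (i - 1)" and a: "a \<in> S"
    and least: "\<And>y. y \<in> S \<Longrightarrow> y \<noteq> a \<Longrightarrow> lexless lt b a y"
  shows "lexmin lt b S = a"
  unfolding lexmin_def
proof (rule the_equality)
  show "a \<in> S \<and> (\<forall>y\<in>S. y \<noteq> a \<longrightarrow> lexless lt b a y)" using a least by simp
  fix a' assume a': "a' \<in> S \<and> (\<forall>y\<in>S. y \<noteq> a' \<longrightarrow> lexless lt b a' y)"
  show "a' = a"
  proof (rule ccontr)
    assume ne: "a' \<noteq> a"
    define k where "k = (GREATEST k. k \<le> i \<and> coord b a k \<noteq> coord b a' k)"
    have k': "k = (GREATEST k. k \<le> i \<and> coord b a' k \<noteq> coord b a k)"
      unfolding k_def by (simp add: eq_commute)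
    have "lexless lt b a a'" "lexless lt b a' a" using a a' least ne by auto
    then have "lt (coord b a k) (coord b a' k)" "lt (coord b a' k) (coord b a k)"
      using lexless_iff[OF i, of a b a' lt] lexless_iff[OF i, of a' b a lt] S a a'
      unfolding k_def[symmetric] k'[symmetric] Let_def by auto
    then show False using lt unfolding strict_total_order_def by blast
  qed
qed

text \<open>\<open>b i\<close> has the smallest possible coordinates: \<open>0\<close> below
  \<open>i\<close>, and \<open>1\<close> at \<open>i\<close>, where the level forbids
  \<open>0\<close>.\<close>

lemma basis_vector_lexless:
  fixes b :: "nat \<Rightarrow> ('n::finite \<Rightarrow> 'a::ring_1)"
  assumes b: "ordered_basis b" and i: "i \<in> {1..CARD('n)}"
    and lt0: "\<And>r. r \<noteq> 0 \<Longrightarrow> lt 0 r" and lt1: "\<And>r. r \<noteq> 0 \<Longrightarrow> r \<noteq> 1 \<Longrightarrow> lt 1 r"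
    and bi: "b i \<in> Vspan b i - Vspan b (i - 1)"
    and y: "y \<in> Vspan b i - Vspan b (i - 1)" "y \<noteq> b i"
  shows "lexless lt b (b i) y"
proof -
  have iN: "i \<le> CARD('n)" "i - 1 \<le> CARD('n)" using i by auto
  define k where "k = (GREATEST k. k \<le> i \<and> coord b (b i) k \<noteq> coord b y k)"
  have "coord b y \<noteq> coord b (b i)" using lincomb_coord(1)[OF b] y(2) by metis
  then obtain j where j: "coord b (b i) j \<noteq> coord b y j" by fastforce
  have "j \<le> i"
  proof (rule ccontr)
    assume "\<not> j \<le> i"
    then show False using j y(1) Vspan_iff_coord[OF b iN(1)] coord_basis[OF b i] by auto
  qed
  with j have "j \<le> i \<and> coord b (b i) j \<noteq> coord b y j" by simp
  then have k: "k \<le> i \<and> coord b (b i) k \<noteq> coord b y k"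
    unfolding k_def by (rule GreatestI_nat[where b = i]) simp
  have "lt (coord b (b i) k) (coord b y k)"
  proof (cases "k = i")
    case True
    obtain j where j: "j > i - 1" "coord b y j \<noteq> 0"
      using y(1) Vspan_iff_coord[OF b iN(2)] by blast
    moreover have "\<not> j > i" using j(2) y(1) Vspan_iff_coord[OF b iN(1)] by blast
    ultimately have "j = i" by linarith
    then have "coord b y i \<noteq> 0" using j(2) by simp
    then show ?thesis using True k coord_basis[OF b i] lt1 by simp
  next
    case False
    then show ?thesis using k coord_basis[OF b i] lt0 by simp
  qed
  then show ?thesis using lexless_iff[OF i bi y(1), of lt] y(2) unfolding k_def Let_def by auto
qed

text \<open>Ranking elements by decreasing size of \<open>R x\<close> lets
  \<open>\<alpha> = 1\<close> witness respectfulness; \<open>f\<close> breaks ties, and the offset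
  \<open>2\<close> reserves the first ranks for \<open>0\<close> and \<open>1\<close>.\<close>

lemma exists_respectful_order:
  obtains lt :: "'a::{ring_1,finite} \<Rightarrow> 'a \<Rightarrow> bool"
  where "respectful_order lt" "\<And>r. r \<noteq> 0 \<Longrightarrow> lt 0 r" "\<And>r. r \<noteq> 0 \<Longrightarrow> r \<noteq> 1 \<Longrightarrow> lt 1 r"
proof -
  obtain f :: "'a \<Rightarrow> nat" where f: "inj f"
    using finite_imp_inj_to_nat_seg[OF finite[of "UNIV :: 'a set"]] by blast
  define p :: "'a \<Rightarrow> nat" where
    "p x = (if x = 0 then 0 else if x = 1 then 1 else 2 + (CARD('a) - card (lgen x)))" for x
  define lt where "lt x y \<longleftrightarrow> p x < p y \<or> (p x = p y \<and> f x < f y)" for x y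
  have le: "card (lgen x) \<le> CARD('a)" for x :: 'a by (rule card_mono) simp_all
  have "strict_total_order lt"
    unfolding strict_total_order_def
  proof (intro conjI allI impI)
    show "lt x y \<or> lt y x" if "x \<noteq> y" for x y
      using that injD[OF f, of x y] unfolding lt_def by (metis linorder_neqE_nat)
  qed (auto simp: lt_def)
  moreover have "lt (1 * x) (u * y)"
    if x: "x \<noteq> 0" and y: "y \<noteq> 0" and yx: "lgen y \<subset> lgen x" and u: "unit_of u" for x y u
  proof -
    obtain v where v: "v * u = 1" using u unfolding unit_of_def by blast
    have "u * y \<noteq> 0" using v y by (metis mult.assoc mult_1 mult_zero_right)
    have "lgen (u * y) \<subseteq> lgen y" unfolding lgen_def by (auto simp: mult.assoc[symmetric])
    then have "lgen (u * y) \<subset> lgen x" using yx by blast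
    then have c: "card (lgen (u * y)) < card (lgen x)" by (intro psubset_card_mono) simp_all
    \<comment> \<open>The early rank of \<open>1\<close> does no harm: generating all of
      \<open>R\<close>, it is never of the form \<open>u * y\<close> for a strictly smaller
      \<open>R y\<close>.\<close>
    have "lgen (1::'a) = UNIV" unfolding lgen_def by simp
    then have "u * y \<noteq> 1" using c le[of x] by auto
    then show ?thesis using c le[of x] \<open>u * y \<noteq> 0\<close> x unfolding lt_def p_def by auto
  qed
  moreover have "unit_of (1::'a)" unfolding unit_of_def by auto
  ultimately have "respectful_order lt" unfolding respectful_order_def by blast
  then show ?thesis by (rule that) (auto simp: lt_def p_def)
qed

text \<open>Each tested vector is nonzero, as \<open>\<gamma> \<noteq> 0\<close> and
  \<open>b\<close> is independent, and stays in \<open>Vspan b m\<close>, where \<open>P\<close>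
  holds. So the next basis vector is admissible, and it is the least of its level.\<close>

lemma greedy_eq_Vspan:
  fixes b :: "nat \<Rightarrow> ('n::finite \<Rightarrow> 'a::ring_1)"
  assumes b: "ordered_basis b" and sto: "strict_total_order lt"
    and lt0: "\<And>r. r \<noteq> 0 \<Longrightarrow> lt 0 r" and lt1: "\<And>r. r \<noteq> 0 \<Longrightarrow> r \<noteq> 1 \<Longrightarrow> lt 1 r"
    and \<Gamma>: "0 \<notin> \<Gamma>" and m: "m \<le> CARD('n)"
    and P: "\<And>x. x \<in> Vspan b m \<Longrightarrow> x \<noteq> vzero \<Longrightarrow> P x" and i: "i \<le> m"
  shows "greedy lt b P \<Gamma> i = Vspan b i"
  using i
proof (induction i)
  case 0
  show ?case unfolding Vspan_def by (simp add: lincomb_0)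
next
  case (Suc i)
  then have IH: "greedy lt b P \<Gamma> i = Vspan b i" by simp
  have iN: "Suc i \<in> {1..CARD('n)}" "i \<le> CARD('n)" using Suc.prems m by auto
  define S where "S = {a \<in> Vspan b (Suc i) - Vspan b i.
    \<forall>\<gamma>\<in>\<Gamma>. \<forall>c\<in>greedy lt b P \<Gamma> i. P (vadd (vsmult \<gamma> a) c)}"
  have indep: "r = 0" if "vsmult r (b (Suc i)) \<in> Vspan b i" for r
  proof -
    define d where "d j = (if j = Suc i then r else 0)" for j
    let ?e = "\<lambda>j. if j = Suc i then 1 else 0"
    have "vsmult r (b (Suc i)) = vsmult r (lincomb ?e b CARD('n))"
      using lincomb_single[OF iN(1), of b] by simp
    also have "\<dots> = lincomb (\<lambda>j. r * ?e j) b CARD('n)"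
      unfolding vsmult_def lincomb_def by (simp add: sum_distrib_left mult.assoc)
    also have "\<dots> = lincomb d b CARD('n)" by (intro lincomb_cong) (simp add: d_def)
    finally have "vsmult r (b (Suc i)) = lincomb d b CARD('n)" .
    moreover have "coord b (lincomb d b CARD('n)) = d"
      by (rule coord_lincomb[OF b]) (use iN in \<open>auto simp: d_def\<close>)
    ultimately have "coord b (vsmult r (b (Suc i))) = d" by simp
    then show ?thesis using that Vspan_iff_coord[OF b iN(2)] unfolding d_def by auto
  qed
  have sub: "left_submodule (Vspan b m)" by (rule left_submodule_Vspan)
  have bm: "b (Suc i) \<in> Vspan b m" using Suc.prems by (intro Vspan_basis) auto
  have bi: "b (Suc i) \<in> Vspan b (Suc i) - Vspan b i"
  proof -
    have "vsmult 1 (b (Suc i)) = b (Suc i)" unfolding vsmult_def by simp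
    then have "b (Suc i) \<notin> Vspan b i" using indep[of 1] by auto
    then show ?thesis using Vspan_basis[of "Suc i" "Suc i" b] by simp
  qed
  have "P (vadd (vsmult \<gamma> (b (Suc i))) c)" if "\<gamma> \<in> \<Gamma>" "c \<in> Vspan b i" for \<gamma> c
  proof (rule P)
    have "c \<in> Vspan b m" using that(2) Vspan_mono[of i m b] Suc.prems by auto
    then show "vadd (vsmult \<gamma> (b (Suc i))) c \<in> Vspan b m"
      using sub bm unfolding left_submodule_def by simp
    show "vadd (vsmult \<gamma> (b (Suc i))) c \<noteq> vzero"
    proof
      assume "vadd (vsmult \<gamma> (b (Suc i))) c = vzero"
      then have "\<gamma> * b (Suc i) j = - 1 * c j" for j
        unfolding vadd_def vsmult_def vzero_def fun_eq_iff by (simp add: eq_neg_iff_add_eq_0)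
      then have "vsmult \<gamma> (b (Suc i)) = vsmult (- 1) c" unfolding vsmult_def by blast
      then have "vsmult \<gamma> (b (Suc i)) \<in> Vspan b i"
        using left_submodule_Vspan[of b i] that(2) unfolding left_submodule_def by simp
      then show False using indep that(1) \<Gamma> by blast
    qed
  qed
  then have biS: "b (Suc i) \<in> S" using bi IH unfolding S_def by blast
  have "lexmin lt b S = b (Suc i)"
  proof (rule lexmin_eqI[OF sto iN(1) _ biS])
    show SV: "S \<subseteq> Vspan b (Suc i) - Vspan b (Suc i - 1)" unfolding S_def by auto
    show "lexless lt b (b (Suc i)) y" if "y \<in> S" "y \<noteq> b (Suc i)" for y
      using basis_vector_lexless[OF b iN(1), of lt y] lt0 lt1 bi that SV by auto
  qed
  moreover have "S \<noteq> {}" using biS by blast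
  moreover have "greedy lt b P \<Gamma> (Suc i) = (if S = {} then greedy lt b P \<Gamma> i
      else {vadd (vsmult r (lexmin lt b S)) c |r c. c \<in> greedy lt b P \<Gamma> i})"
    unfolding S_def by (simp only: greedy.simps Let_def)
  ultimately have "greedy lt b P \<Gamma> (Suc i) = {vadd (vsmult r (b (Suc i))) c |r c. c \<in> Vspan b i}"
    using IH by simp
  also have "\<dots> = Vspan b (Suc i)"
  proof (intro equalityI subsetI)
    fix x assume "x \<in> {vadd (vsmult r (b (Suc i))) c |r c. c \<in> Vspan b i}"
    then show "x \<in> Vspan b (Suc i)"
      using bi Vspan_mono[of i "Suc i" b] left_submodule_Vspan[of b "Suc i"]
      unfolding left_submodule_def by auto
  next
    fix x assume "x \<in> Vspan b (Suc i)"
    then obtain c where "x = lincomb c b (Suc i)" unfolding Vspan_def by blast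
    then have "x = vadd (vsmult (c (Suc i)) (b (Suc i))) (lincomb c b i)"
      unfolding lincomb_Suc vadd_def by (simp add: add.commute)
    then show "x \<in> {vadd (vsmult r (b (Suc i))) c |r c. c \<in> Vspan b i}"
      unfolding Vspan_def by blast
  qed
  finally show ?case .
qed

text \<open>The multiplier \<open>r = 0\<close> keeps the old code inside the new one.\<close>

lemma greedy_mono:
  fixes P :: "('n::finite \<Rightarrow> 'a::ring_1) \<Rightarrow> bool"
  assumes "i \<le> j"
  shows "greedy lt b P \<Gamma> i \<subseteq> greedy lt b P \<Gamma> j"
  using assms
proof (induction j rule: dec_induct)
  case (step j)
  have "x = vadd (vsmult 0 a) x" for x a :: "'n \<Rightarrow> 'a"
    unfolding vadd_def vsmult_def by simp
  then have "greedy lt b P \<Gamma> j \<subseteq> greedy lt b P \<Gamma> (Suc j)"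
    unfolding greedy.simps Let_def by auto
  then show ?case using step.IH by blast
qed simp

theorem mainTheorem11:
  fixes P :: "('n::finite \<Rightarrow> 'a::{ring_1,finite}) \<Rightarrow> bool"
    and C :: "('n \<Rightarrow> 'a) set"
    and \<Gamma> :: "'a set"
  assumes "principal_left_ideal_ring TYPE('a)"
    and "multiplicative P"
    and "free_submodule C"
    and "\<forall>x\<in>C. x \<noteq> vzero \<longrightarrow> P x"
    and "gamma_set \<Gamma>"
  shows "\<exists>lt b. respectful_order lt \<and> ordered_basis b \<and> C \<subseteq> lexicode lt b P \<Gamma>"
proof -
  obtain m g where g: "C = Vspan g m" "lin_indep g m"
    using assms(3) unfolding free_submodule_def by blast
  obtain b where b: "ordered_basis b" "\<forall>i\<in>{1..m}. b i = g i" "m \<le> CARD('n)"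
    using lin_indep_extends_to_ordered_basis[OF assms(1) g(2)] by blast
  have "lincomb c g m = lincomb c b m" for c using b(2) by (intro lincomb_cong) simp
  then have C: "C = Vspan b m" unfolding g(1) Vspan_def by simp
  obtain lt :: "'a \<Rightarrow> 'a \<Rightarrow> bool" where lt: "respectful_order lt"
    "\<And>r. r \<noteq> 0 \<Longrightarrow> lt 0 r" "\<And>r. r \<noteq> 0 \<Longrightarrow> r \<noteq> 1 \<Longrightarrow> lt 1 r"
    using exists_respectful_order by blast
  have "strict_total_order lt" using lt(1) unfolding respectful_order_def by simp
  moreover have "0 \<notin> \<Gamma>" using assms(5) unfolding gamma_set_def by blast
  ultimately have "greedy lt b P \<Gamma> m = C"
    using greedy_eq_Vspan[OF b(1) _ lt(2,3) _ b(3), where i = m] assms(4) unfolding C by simp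
  then have "C \<subseteq> lexicode lt b P \<Gamma>"
    unfolding lexicode_def using greedy_mono[OF b(3)] by metis
  then show ?thesis using lt(1) b(1) by blast
qed

end
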